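(* There exists a canonical routing labeling scheme for rooted trees on $n$ nodes with labels of length $\log n+\mathcal{O}\big(\sqrt{\log n\cdot\log\log n}\big)$ bits.
   Context: All logarithms are base $2$. A (designer-port) routing labeling scheme for a family $\mathcal{T}$ of rooted trees consists of an encoder and a decoder. - The encoder is given $T\in\mathcal{T}$. It assigns a binary string (label) $\ell(u)$ to every node $u$. It also labels the edges from each node $u$ to its $\deg(u)$ children with distinct port numbers from $\{1,\dots,\deg(u)\}$; the encoder is free to choose these port numbers. - The decoder receives only $\ell(u)$ and $\ell(w)$ for nodes $u\neq w$ of some $T\in\mathcal{T}$; the value $\lceil\log n\rceil$, where $n=|T|$, may also be assumed known. It must return $0$ if the next node on the path from $u$ to $w$ is the parent of $u$. Otherwise it must return the port number of the first edge on that path. - The length of the scheme is the maximum label length over all trees in $\mathcal{T}$ and all their nodes. A port assignment is canonical if, for every node $v$ with children $v_1,\dots,v_i$ ordered so that $|T_{v_1}|\ge\dots\ge|T_{v_i}|$, the edge from $v$ to $v_j$ gets port $j$. Here $T_v$ denotes the subtree rooted at $v$; ties may be broken arbitrarily. A scheme is canonical if its encoder always produces a canonical port assignment. *)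

theory Defs
  imports Complex_Main
begin

definition rooted_tree :: "nat \<Rightarrow> nat \<Rightarrow> (nat \<Rightarrow> nat) \<Rightarrow> bool" where
  "rooted_tree n r p \<longleftrightarrow> r < n \<and> p r = r \<and>
     (\<forall>v<n. p v < n \<and> (\<exists>k. (p ^^ k) v = r))"

definition children :: "nat \<Rightarrow> nat \<Rightarrow> (nat \<Rightarrow> nat) \<Rightarrow> nat \<Rightarrow> nat set" where
  "children n r p v = {w. w < n \<and> w \<noteq> r \<and> p w = v}"

definition subtree :: "nat \<Rightarrow> (nat \<Rightarrow> nat) \<Rightarrow> nat \<Rightarrow> nat set" where
  "subtree n p v = {w. w < n \<and> (\<exists>k. (p ^^ k) w = v)}"

text \<open>port c is the port number of the edge from p c to its child c.
  Ports at each node v are a bijection from its children onto {1..deg v}.\<close>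
definition valid_ports :: "nat \<Rightarrow> nat \<Rightarrow> (nat \<Rightarrow> nat) \<Rightarrow> (nat \<Rightarrow> nat) \<Rightarrow> bool" where
  "valid_ports n r p port \<longleftrightarrow>
     (\<forall>v<n. bij_betw port (children n r p v) {1..card (children n r p v)})"

text \<open>Canonical: children with strictly larger subtrees get strictly smaller ports
  (equivalently, ports follow a non-increasing ordering of subtree sizes, ties arbitrary).\<close>
definition canonical_ports :: "nat \<Rightarrow> nat \<Rightarrow> (nat \<Rightarrow> nat) \<Rightarrow> (nat \<Rightarrow> nat) \<Rightarrow> bool" where
  "canonical_ports n r p port \<longleftrightarrow> valid_ports n r p port \<and>
     (\<forall>v<n. \<forall>c1\<in>children n r p v. \<forall>c2\<in>children n r p v.
        card (subtree n p c1) > card (subtree n p c2) \<longrightarrow> port c1 < port c2)"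

text \<open>Required decoder output for u \<noteq> w: 0 if the next hop is the parent of u,
  otherwise the port of the child of u whose subtree contains w.\<close>
definition route_answer :: "nat \<Rightarrow> nat \<Rightarrow> (nat \<Rightarrow> nat) \<Rightarrow> (nat \<Rightarrow> nat) \<Rightarrow> nat \<Rightarrow> nat \<Rightarrow> nat" where
  "route_answer n r p port u w =
     (if w \<in> subtree n p u
      then port (THE c. c \<in> children n r p u \<and> w \<in> subtree n p c)
      else 0)"

definition canonical_routing_scheme ::
  "(nat \<Rightarrow> nat \<Rightarrow> (nat \<Rightarrow> nat) \<Rightarrow> (nat \<Rightarrow> bool list) \<times> (nat \<Rightarrow> nat))
   \<Rightarrow> (nat \<Rightarrow> bool list \<Rightarrow> bool list \<Rightarrow> nat) \<Rightarrow> bool" where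
  "canonical_routing_scheme enc dec \<longleftrightarrow>
     (\<forall>n r p. rooted_tree n r p \<longrightarrow>
        canonical_ports n r p (snd (enc n r p)) \<and>
        (\<forall>u<n. \<forall>w<n. u \<noteq> w \<longrightarrow>
           dec (nat \<lceil>log 2 (real n)\<rceil>) (fst (enc n r p) u) (fst (enc n r p) w)
             = route_answer n r p (snd (enc n r p)) u w))"

end

theory Submission
  imports Defs "HOL-Real_Asymp.Real_Asymp"
begin

text \<open>
  Write L for the rounded logarithm of n. Every node gets an integer position: a child is placed at the
  position of its parent plus an offset, the light children (ports at least 2) first and the heavy
  child (port 1) behind them, so that a subtree of size s fits into a window of length
  cap s = 2 D s^(1 + 32 / D) at the position of its root. The decoder looks only at the parameters
  of u and at the difference of the two positions. The parameters are the approximate window length,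
  the approximate length of the part for the light children, and the relative widths of their slots.

  The widths need few bits: if z denotes the logarithm of twice the inverse of the relative size of
  the j-th light child, then only the step of the scale (1 + 1/D)^t below z is recorded, and only for
  ranks j whose logarithm runs through the same scale. This leaves a monotone lattice path
  of O(D log L) steps. The loss caused by both roundings is compensated by the exponent 1 + 32 / D,
  since the j-th child contains at most 1 / j of the nodes. Positions take L + O(L / D + D) bits, and
  D of order sqrt (L / log L) balances this against the paths.
\<close>

subsection \<open>Geometric scales\<close>

definition geo :: "nat \<Rightarrow> nat \<Rightarrow> real" where
  "geo D t = (1 + 1 / real D) ^ t"

definition lev :: "nat \<Rightarrow> real \<Rightarrow> nat" where
  "lev D x = nat \<lfloor>log (1 + 1 / real D) x\<rfloor>"

lemma geo_pos: "0 < geo D t"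
  by (auto simp: geo_def intro!: zero_less_power add_pos_nonneg)

lemma geo_ge_1: "1 \<le> geo D t"
  by (auto simp: geo_def)

lemma geo_mono: "s \<le> t \<Longrightarrow> geo D s \<le> geo D t"
  unfolding geo_def by (rule power_increasing) auto

lemma geo_Suc: "geo D (Suc t) = geo D t * (1 + 1 / real D)"
  by (simp add: geo_def)

lemma geo_powr: "D > 0 \<Longrightarrow> geo D t = (1 + 1 / real D) powr real t"
  unfolding geo_def by (subst powr_realpow) (auto intro: add_pos_nonneg)

lemma geo_lev_le:
  assumes "D > 0" "1 \<le> x"
  shows "geo D (lev D x) \<le> x"
proof -
  have b: "1 + 1 / real D > 1" using assms by simp
  have "0 \<le> log (1 + 1 / real D) x" using b assms by simp
  then have "real (lev D x) \<le> log (1 + 1 / real D) x" unfolding lev_def by linarith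
  then have "(1 + 1 / real D) powr real (lev D x) \<le> x"
    using b assms by (subst (asm) le_log_iff) auto
  then show ?thesis using assms geo_powr by simp
qed

lemma less_geo_Suc_lev:
  assumes "D > 0" "1 \<le> x"
  shows "x < geo D (Suc (lev D x))"
proof -
  have b: "1 + 1 / real D > 1" using assms by simp
  have "log (1 + 1 / real D) x < real (Suc (lev D x))" unfolding lev_def by linarith
  then have "x < (1 + 1 / real D) powr real (Suc (lev D x))"
    using b assms by (subst (asm) log_less_iff) auto
  then show ?thesis using assms geo_powr by metis
qed

lemma lev_mono:
  assumes "D > 0" "1 \<le> x" "x \<le> y"
  shows "lev D x \<le> lev D y"
  unfolding lev_def using assms by (intro nat_mono floor_mono) simp

lemma two_le_geo:
  assumes "D > 0"
  shows "2 \<le> geo D D"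
proof -
  have "- 1 \<le> 1 / real D" by (rule order_trans[of _ 0]) auto
  then show ?thesis using Bernoulli_inequality[of "1 / real D" D] assms by (simp add: geo_def)
qed

text \<open>Since \<open>geo D D\<close> is at least 2 by Bernoulli's inequality, a doubling takes
  at most \<open>D\<close> steps of the scale.\<close>

lemma lev_le:
  assumes "D > 0" "1 \<le> x"
  shows "real (lev D x) \<le> real D * log 2 x"
proof -
  let ?b = "1 + 1 / real D"
  have b: "?b > 1" using assms by simp
  have "1 \<le> log 2 (geo D D)" using two_le_geo[OF assms(1)] by simp
  also have "\<dots> = real D * log 2 ?b" using b by (simp add: geo_def log_nat_power)
  finally have *: "1 \<le> real D * log 2 ?b" .
  have "real (lev D x) \<le> log ?b x" unfolding lev_def using b assms by simp
  also have "\<dots> = log 2 x / log 2 ?b" using b assms by (simp add: log_def)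
  also have "\<dots> \<le> real D * log 2 x"
  proof -
    have "0 < log 2 ?b" by (subst zero_less_log_cancel_iff) (use b in linarith)+
    moreover have "log 2 x * 1 \<le> log 2 x * (real D * log 2 ?b)"
      using * assms by (intro mult_left_mono) auto
    ultimately show ?thesis by (simp add: divide_le_eq mult_ac)
  qed
  finally show ?thesis .
qed

section \<open>Power inequalities and comparison of sums\<close>

lemma one_plus_le_two_powr:
  assumes "0 \<le> x" shows "1 + x \<le> (2::real) powr (2 * x)"
proof -
  \<comment> \<open>This is \<open>ln (1 - x) \<le> - x\<close> at \<open>x = 1/2\<close>.\<close>
  have "(1::real)/2 \<le> ln 2" using ln_one_minus_pos_upper_bound[of "1/2"]
    by (simp add: ln_div)
  then have "x \<le> 2 * x * ln 2" using assms
    using mult_left_mono[of "1/2" "ln 2" "2*x"] by simp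
  then have "exp x \<le> 2 powr (2 * x)" by (simp add: powr_def)
  then show ?thesis using exp_ge_add_one_self[of x] by linarith
qed

text \<open>By the mean value theorem the increment is \<open>(1 + d) * z powr d\<close> with
  \<open>z\<close> below \<open>j + 1\<close>. As \<open>j + 1\<close> is at least 2, the factor
  \<open>1 + d\<close> is at most \<open>(j + 1) powr (2 * d)\<close>.\<close>

lemma powr_increment_le:
  assumes d: "0 \<le> d" and "1 \<le> (j::nat)"
  shows "(real j + 1) powr (1 + d) - real j powr (1 + d) \<le> (real j + 1) powr (3 * d)"
proof -
  let ?y = "real j + 1"
  have "\<exists>z. z > real j \<and> z < real j + 1 \<and>
    ?y powr (1 + d) - real j powr (1 + d) = (real j + 1 - real j) * ((1 + d) * z powr d)"
    apply (rule MVT2) using assms by (auto intro!: derivative_eq_intros)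
  then obtain z where z: "z > real j" "z < ?y"
    "?y powr (1 + d) - real j powr (1 + d) = (1 + d) * z powr d" by auto
  have "(1 + d) * z powr d \<le> 2 powr (2 * d) * ?y powr d"
    using z d by (intro mult_mono one_plus_le_two_powr powr_mono2) auto
  also have "\<dots> \<le> ?y powr (2 * d) * ?y powr d"
    using assms by (intro mult_right_mono powr_mono2) auto
  also have "\<dots> = ?y powr (3 * d)" by (simp flip: powr_add)
  finally show ?thesis using z by simp
qed

lemma sum_powr_ge:
  assumes "0 \<le> d"
  shows "(real y + 1) powr (1 + d) - 1 \<le> (\<Sum>j = 1..y. (real j + 1) powr (3 * d))"
proof (induction y)
  case (Suc y)
  show ?case using powr_increment_le[OF assms, of "Suc y"] Suc by (simp add: algebra_simps)
qed simp

text \<open>Abel summation: \<open>h\<close> is a nonnegative combination of indicators of initial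
  segments \<open>{1..y}\<close>, and for one indicator the claim is \<open>cnt\<close>. It bounds
  the loss when each rank is replaced by a representative.\<close>

lemma sum_antimono_compose_le:
  fixes h w :: "nat \<Rightarrow> real"
  assumes anti: "\<And>i j. 1 \<le> i \<Longrightarrow> i \<le> j \<Longrightarrow> j \<le> k \<Longrightarrow> h j \<le> h i"
    and nonneg: "\<And>j. 1 \<le> j \<Longrightarrow> j \<le> k \<Longrightarrow> 0 \<le> h j"
    and phi: "\<And>j. 1 \<le> j \<Longrightarrow> j \<le> k \<Longrightarrow> 1 \<le> \<phi> j \<and> \<phi> j \<le> k"
    and cnt: "\<And>y. 1 \<le> y \<Longrightarrow> y \<le> k \<Longrightarrow> real (card {j\<in>{1..k}. \<phi> j \<le> y}) \<le> (\<Sum>j = 1..y. w j)"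
  shows "(\<Sum>j = 1..k. h (\<phi> j)) \<le> (\<Sum>j = 1..k. w j * h j)"
proof -
  \<comment> \<open>\<open>d y\<close> is the coefficient of the indicator of \<open>{1..y}\<close>;
    beyond \<open>k\<close> the function counts as 0.\<close>
  define d where "d y = h y - (if y = k then 0 else h (Suc y))" for y
  have d0: "0 \<le> d y" if "1 \<le> y" "y \<le> k" for y
    using that anti[of y "Suc y"] nonneg[of y] by (auto simp: d_def)
  have tel: "h x = (\<Sum>y | y \<in> {1..k} \<and> x \<le> y. d y)" if "1 \<le> x" "x \<le> k" for x
  proof -
    have "(\<Sum>y = x..k. d y) = h x" using that(2,1)
    proof (induction rule: inc_induct)
      case base then show ?case by (simp add: d_def)
    next
      case (step m)
      then show ?case by (simp add: sum.atLeast_Suc_atMost d_def)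
    qed
    moreover have "{y. y \<in> {1..k} \<and> x \<le> y} = {x..k}" using that by auto
    ultimately show ?thesis by simp
  qed
  have "(\<Sum>j = 1..k. h (\<phi> j)) = (\<Sum>j = 1..k. \<Sum>y | y \<in> {1..k} \<and> \<phi> j \<le> y. d y)"
    using phi by (intro sum.cong refl tel) auto
  also have "\<dots> = (\<Sum>y = 1..k. \<Sum>j | j \<in> {1..k} \<and> \<phi> j \<le> y. d y)"
    by (rule sum.swap_restrict) auto
  also have "\<dots> = (\<Sum>y = 1..k. real (card {j\<in>{1..k}. \<phi> j \<le> y}) * d y)" by simp
  also have "\<dots> \<le> (\<Sum>y = 1..k. (\<Sum>j = 1..y. w j) * d y)"
    using cnt d0 by (intro sum_mono mult_right_mono) auto
  also have "\<dots> = (\<Sum>y = 1..k. \<Sum>j | j \<in> {1..k} \<and> j \<le> y. w j * d y)"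
  proof (intro sum.cong refl)
    fix y assume "y \<in> {1..k}"
    then have "{j. j \<in> {1..k} \<and> j \<le> y} = {1..y}" by auto
    then show "(\<Sum>j = 1..y. w j) * d y = (\<Sum>j | j \<in> {1..k} \<and> j \<le> y. w j * d y)"
      by (simp add: sum_distrib_right)
  qed
  also have "\<dots> = (\<Sum>j = 1..k. \<Sum>y | y \<in> {1..k} \<and> j \<le> y. w j * d y)"
    by (rule sum.swap_restrict[symmetric]) auto
  also have "\<dots> = (\<Sum>j = 1..k. w j * h j)"
    by (intro sum.cong refl) (simp add: tel sum_distrib_left)
  finally show ?thesis .
qed

text \<open>Decodes a monotone sequence \<tau> from the set of all \<tau> g + g: these are
  strictly increasing, so the set determines the sequence.\<close>
definition prof :: "nat set \<Rightarrow> nat \<Rightarrow> nat" where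
  "prof A g = sorted_list_of_set A ! g - g"

text \<open>A monotone sequence of \<open>T + 1\<close> values up to \<open>T\<close> thus costs
  \<open>2 * T + 1\<close> bits, one per element of \<open>{..2 * T}\<close>.\<close>

lemma ex_prof:
  assumes mono: "\<And>g g'. g \<le> g' \<Longrightarrow> \<tau> g \<le> \<tau> g'" and "\<And>g. \<tau> g \<le> T"
  shows "\<exists>A \<subseteq> {..2 * T}. \<forall>g \<le> T. prof A g = \<tau> g"
proof -
  define xs where "xs = map (\<lambda>g. \<tau> g + g) [0..<Suc T]"
  have sm: "\<tau> g + g < \<tau> g' + g'" if "g < g'" for g g' using that mono[of g g'] by simp
  have sw: "sorted_wrt (<) xs" unfolding xs_def sorted_wrt_map
    by (rule sorted_wrt_mono_rel[OF _ sorted_wrt_upt]) (auto intro: sm)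
  then have "sorted_list_of_set (set xs) = xs"
    by (simp add: sorted_list_of_set.idem_if_sorted_distinct strict_sorted_iff)
  then have "prof (set xs) g = \<tau> g" if "g \<le> T" for g
    using that unfolding prof_def by (simp add: xs_def del: upt_Suc)
  moreover have "set xs \<subseteq> {..2 * T}" using assms(2) by (fastforce simp: xs_def add_mono mult_2)
  ultimately show ?thesis by blast
qed

subsection \<open>Slot widths\<close>

text \<open>The extra exponent pays for multiplicative rounding. The factor
  \<open>2 * real D\<close> makes a share \<open>1 / D\<close> of the window at least 2 as soon as
  \<open>s\<close> is at least 1, which covers rounding to integers.\<close>

definition cap :: "nat \<Rightarrow> real \<Rightarrow> real" where
  "cap D s = 2 * real D * s powr (1 + 32 / real D)"

text \<open>With \<open>z = geo D t\<close> this is the share \<open>2 powr (1 - z)\<close> of a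
  child whose logarithm is exactly \<open>z\<close>, times \<open>2 powr (- 16 * z / D)\<close> for
  the extra exponent of \<open>cap\<close> and the slack \<open>2 powr (10 / D)\<close>.\<close>

definition weight :: "nat \<Rightarrow> nat \<Rightarrow> real" where
  "weight D t = 2 powr (1 + 10 / real D - geo D t * (1 + 16 / real D))"

text \<open>The width depends on \<open>j\<close> only through the level of its logarithm;
  \<open>j + 1\<close> keeps that logarithm at least 1.\<close>

definition slot_weight :: "nat \<Rightarrow> nat set \<Rightarrow> nat \<Rightarrow> real" where
  "slot_weight D A j = weight D (prof A (lev D (log 2 (real j + 1))))"

text \<open>The leading 1 keeps the first slot away from the position of the parent.\<close>

definition off :: "nat \<Rightarrow> nat \<Rightarrow> nat set \<Rightarrow> nat \<Rightarrow> nat" where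
  "off D e A j = 1 + nat \<lfloor>geo D e * (\<Sum>i = 1..<j. slot_weight D A i)\<rfloor>"

definition blk :: "nat \<Rightarrow> nat \<Rightarrow> nat" where
  "blk D e = nat \<lceil>geo D e\<rceil> + 1"

lemma weight_pos: "0 < weight D t"
  by (simp add: weight_def)

lemma weight_antimono: "s \<le> t \<Longrightarrow> weight D t \<le> weight D s"
  unfolding weight_def using geo_mono[of s t D] by (simp add: mult_right_mono)

lemma off_mono:
  assumes "i \<le> j" shows "off D e A i \<le> off D e A j"
proof -
  have "(\<Sum>i = 1..<i. slot_weight D A i) \<le> (\<Sum>i = 1..<j. slot_weight D A i)"
    using assms by (intro sum_mono2) (auto simp: slot_weight_def weight_pos less_imp_le)
  then show ?thesis unfolding off_def using geo_pos[of D e]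
    by (intro add_left_mono nat_mono floor_mono mult_left_mono) auto
qed

lemma off_Suc_ge:
  assumes "1 \<le> j"
  shows "real (off D e A j) + geo D e * slot_weight D A j - 1 \<le> real (off D e A (Suc j))"
proof -
  let ?S = "\<Sum>i = 1..<j. slot_weight D A i"
  have "0 \<le> geo D e * ?S"
    by (intro mult_nonneg_nonneg sum_nonneg)
      (auto simp: slot_weight_def weight_pos geo_pos less_imp_le)
  then have "real (off D e A j) \<le> 1 + geo D e * ?S" unfolding off_def by linarith
  moreover have "geo D e * (?S + slot_weight D A j) \<le> real (off D e A (Suc j))"
    using assms unfolding off_def by simp linarith
  ultimately show ?thesis by (simp add: algebra_simps)
qed

text \<open>The factors are the losses in \<open>ex_slots\<close>: \<open>1 + 2 * d\<close> for the
  enlarged window and one more position, \<open>1 + d\<close> for the step of the scale,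
  \<open>1 - d\<close> for subtracting 2 from the block. Their exponents add up to 4 + 2 + 4 =
  10.\<close>

lemma slack_le:
  assumes "D \<ge> 4"
  defines "d \<equiv> 1 / real D"
  shows "(1 + 2 * d) * (1 + d) / (1 - d) \<le> 2 powr (10 * d)"
proof -
  have d: "0 < d" "d \<le> 1/4" using assms by (auto simp: field_simps)
  have "1 / (1 - d) \<le> 1 + 2 * d"
  proof -
    have "0 \<le> d * (1 - 2 * d)" using d by (intro mult_nonneg_nonneg) auto
    then have "1 \<le> (1 + 2 * d) * (1 - d)" by (simp add: algebra_simps)
    then show ?thesis using d by (simp add: divide_le_eq)
  qed
  then have "(1 + 2 * d) * (1 + d) * (1 / (1 - d)) \<le>
      2 powr (2 * (2 * d)) * 2 powr (2 * d) * 2 powr (2 * (2 * d))"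
    using d one_plus_le_two_powr[of d] one_plus_le_two_powr[of "2 * d"]
    by (intro mult_mono) auto
  also have "\<dots> = 2 powr (10 * d)" by (simp flip: powr_add)
  finally show ?thesis by simp
qed

text \<open>With \<sigma> = f / lam and \<rho> = f / s, a child of size f needs the share
  \<sigma> * \<rho> powr (32 / D) of the block; the factor 2 powr (10 / D) pays for all roundings.\<close>
lemma weight_ge:
  fixes f lam s :: real
  assumes D: "D \<ge> 4" and f: "1 \<le> f" "f \<le> lam" "lam \<le> s" "2 * f \<le> s"
    and t: "geo D t \<le> log 2 (2 * lam / f)"
  shows "2 powr (10 / real D) * f powr (1 + 32 / real D) \<le> weight D t * (lam * s powr (32 / real D))"
proof -
  define z where "z = geo D t"
  have pos: "lam > 0" "s > 0" using f by auto
  have "2 powr z \<le> 2 * lam / f" using t f unfolding z_def by (subst (asm) le_log_iff) auto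
  then have sig: "f \<le> lam * 2 powr (1 - z)"
    using f by (simp add: powr_diff field_simps)
  \<comment> \<open>For small \<open>z\<close> the hypothesis \<open>2 * f \<le> s\<close> suffices;
    for \<open>z\<close> above 2 the bound \<open>sig\<close> does, since then
    \<open>1 - z \<le> - z / 2\<close>.\<close>
  have rho: "f \<le> s * 2 powr (- z / 2)"
  proof (cases "z \<le> 2")
    case True
    have "s * 2 powr (- 1) \<le> s * 2 powr (- z / 2)"
      using True pos by (intro mult_left_mono powr_mono) auto
    moreover have "2 powr (- 1) = (1 / 2 :: real)" by (simp add: powr_minus)
    ultimately have "s / 2 \<le> s * 2 powr (- z / 2)" by simp
    then show ?thesis using f by linarith
  next
    case False
    have "f \<le> lam * 2 powr (1 - z)" by (fact sig)
    also have "\<dots> \<le> s * 2 powr (- z / 2)"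
      using False f pos by (intro mult_mono powr_mono) auto
    finally show ?thesis .
  qed
  have "f powr (32 / real D) \<le> (s * 2 powr (- z / 2)) powr (32 / real D)"
    using rho f D by (intro powr_mono2) auto
  also have "\<dots> = s powr (32 / real D) * 2 powr (- z * (16 / real D))"
    using pos by (simp add: powr_mult powr_powr mult_ac)
  finally have r2: "f powr (32 / real D) \<le> \<dots>" .
  have "f powr (1 + 32 / real D) = f * f powr (32 / real D)"
    using f by (simp add: powr_add)
  also have "\<dots> \<le> (lam * 2 powr (1 - z)) * (s powr (32 / real D) * 2 powr (- z * (16 / real D)))"
    using sig r2 f pos by (intro mult_mono) auto
  finally have "2 powr (10 / real D) * f powr (1 + 32 / real D) \<le>
     2 powr (10 / real D) * ((lam * 2 powr (1 - z)) * (s powr (32 / real D) * 2 powr (- z * (16 / real D))))"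
    by (intro mult_left_mono) auto
  also have "\<dots> = (2 powr (10 / real D) * 2 powr (1 - z) * 2 powr (- z * (16 / real D))) *
      (lam * s powr (32 / real D))"
    by (simp add: mult_ac)
  also have "2 powr (10 / real D) * 2 powr (1 - z) * 2 powr (- z * (16 / real D)) = weight D t"
    unfolding weight_def z_def[symmetric] powr_add[symmetric] by (simp add: algebra_simps)
  finally show ?thesis .
qed

text \<open>The counterpart of \<open>weight_ge\<close>, needed to fit all slots into the block. As
  the \<open>j\<close>-th child has size at most \<open>lam / j\<close>, the penalty
  \<open>(j + 1) powr (3 / D)\<close> is a small power of the inverse share, and the 16 in
  \<open>weight\<close> absorbs it.\<close>

lemma weight_le:
  fixes f lam :: real
  assumes D: "D \<ge> 4" and f: "1 \<le> f" "f \<le> lam" and j: "1 \<le> j" "real j * f \<le> lam"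
    and t: "log 2 (2 * lam / f) < geo D (Suc t)"
  shows "(real j + 1) powr (3 * (1 / real D)) * weight D t \<le> f / lam"
proof -
  define z where "z = geo D t"
  define d where "d = 1 / real D"
  have d: "0 < d" "d \<le> 1/4" using D by (auto simp: d_def field_simps)
  have z: "1 \<le> z" using geo_ge_1 by (simp add: z_def)
  have g: "geo D (Suc t) = z * (1 + d)" by (simp add: geo_Suc z_def d_def)
  have "2 * lam / f < 2 powr (z * (1 + d))"
    using t f unfolding g by (subst (asm) log_less_iff) auto
  then have big: "2 * lam / f \<le> 2 powr (z * (1 + d))" by simp
  then have sig: "2 powr (1 - z * (1 + d)) \<le> f / lam"
    using f by (simp add: powr_diff field_simps)
  have "real j + 1 \<le> 2 * real j" using j by simp
  also have "\<dots> \<le> 2 * lam / f" using j f by (simp add: field_simps)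
  finally have "real j + 1 \<le> 2 powr (z * (1 + d))" using big by simp
  then have "(real j + 1) powr (3 * d) \<le> (2 powr (z * (1 + d))) powr (3 * d)"
    using d by (intro powr_mono2) auto
  then have "(real j + 1) powr (3 * d) * weight D t \<le> 2 powr (z * (1 + d) * (3 * d)) * weight D t"
    using weight_pos[of D t] by (intro mult_right_mono) (auto simp: powr_powr)
  also have "\<dots> = 2 powr (z * (1 + d) * (3 * d) + (1 + 10 * d - z * (1 + 16 * d)))"
    unfolding weight_def by (simp add: powr_add z_def d_def)
  \<comment> \<open>Of the coefficient 16 of \<open>z * d\<close>, one unit goes to the step of the
    scale and 3 to the penalty; the remaining 12 exceed \<open>10 + 3 * d\<close>, and
    \<open>z \<ge> 1\<close>.\<close>
  also have "\<dots> \<le> 2 powr (1 - z * (1 + d))"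
  proof (rule powr_mono)
    have "1 * d \<le> z * d" using z d by (intro mult_right_mono) auto
    moreover have "z * d * 11 \<le> z * d * (12 - 3 * d)"
      using z d by (intro mult_left_mono) auto
    moreover have "z * d * (12 - 3 * d) = 12 * (z * d) - 3 * (z * d * d)"
      by (simp add: algebra_simps)
    ultimately have "10 * d + 3 * (z * d * d) \<le> 12 * (z * d)"
      using d by linarith
    moreover have "z * (1 + d) * (3 * d) + (1 + 10 * d - z * (1 + 16 * d)) =
       (10 * d + 3 * (z * d * d)) - 12 * (z * d) + (1 - z * (1 + d))"
      by (simp add: algebra_simps)
    ultimately show "z * (1 + d) * (3 * d) + (1 + 10 * d - z * (1 + 16 * d)) \<le> 1 - z * (1 + d)"
      by linarith
  qed simp
  also note sig
  finally show ?thesis by (simp add: d_def)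
qed

section \<open>Compressed profiles of the light children\<close>

lemma sorted_mult_le_sum:
  fixes f :: "nat \<Rightarrow> nat"
  assumes "\<And>i. 1 \<le> i \<Longrightarrow> i \<le> j \<Longrightarrow> f j \<le> f i"
  shows "j * f j \<le> (\<Sum>i = 1..j. f i)"
  using sum_mono[of "{1..j}" "\<lambda>_. f j" f] assms by simp

text \<open>Bounds both coordinates of the path: rank levels and width levels both come from
  logarithms of at most \<open>L + 1\<close>.\<close>

definition max_lev :: "nat \<Rightarrow> nat \<Rightarrow> nat" where
  "max_lev D L = nat \<lfloor>real D * log 2 (real L + 1)\<rfloor>"

lemma lev_le_max_lev:
  assumes "D > 0" "1 \<le> x" "x \<le> real L + 1"
  shows "lev D x \<le> max_lev D L"
proof -
  have "real (lev D x) \<le> real D * log 2 x" using assms by (intro lev_le)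
  also have "\<dots> \<le> real D * log 2 (real L + 1)" using assms by (intro mult_left_mono) auto
  finally show ?thesis unfolding max_lev_def by linarith
qed

text \<open>All ranks on one level share the width of the least of them, \<open>\<phi> j\<close>.
  That child is at least as large, so no slot is too narrow. At most
  \<open>(y + 1) powr (1 + 1 / D) - 1\<close> ranks have a representative up to \<open>y\<close>, so
  \<open>sum_antimono_compose_le\<close> turns the sharing into the penalty absorbed by
  \<open>weight_le\<close>.\<close>

lemma ex_profile:
  fixes f :: "nat \<Rightarrow> nat"
  assumes D: "D \<ge> 4"
    and anti: "\<And>i j. 1 \<le> i \<Longrightarrow> i \<le> j \<Longrightarrow> j \<le> k \<Longrightarrow> f j \<le> f i"
    and f1: "\<And>j. 1 \<le> j \<Longrightarrow> j \<le> k \<Longrightarrow> 1 \<le> f j"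
    and lam: "1 + (\<Sum>j = 1..k. f j) \<le> lam" "lam \<le> 2 ^ L"
  shows "\<exists>A \<subseteq> {..2 * max_lev D L}.
    (\<Sum>j = 1..k. slot_weight D A j) \<le> 1 \<and>
    (\<forall>j. 1 \<le> j \<and> j \<le> k \<longrightarrow> weight D (lev D (log 2 (2 * real lam / real (f j)))) \<le> slot_weight D A j)"
proof (cases "k = 0")
  case True then show ?thesis by (intro exI[of _ "{}"]) auto
next
  case False
  define cls where "cls j = lev D (log 2 (2 * real lam / real (f j)))" for j
  \<comment> \<open>the least rank j whose level lev D (log 2 (j + 1)) is at least g\<close>
  define nn where "nn g = nat \<lceil>2 powr geo D g\<rceil> - 1" for g
  \<comment> \<open>The minimum keeps the rank among the \<open>k\<close> children when level
    \<open>g\<close> is not reached.\<close>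
  define \<tau> where "\<tau> g = cls (min (nn g) k)" for g
  define \<gamma> where "\<gamma> j = lev D (log 2 (real j + 1))" for j :: nat
  define \<phi> where "\<phi> j = nn (\<gamma> j)" for j
  have D0: "D > 0" using D by simp
  have fle: "j * f j \<le> lam" "f j \<le> lam" if "1 \<le> j" "j \<le> k" for j
  proof -
    have "j * f j \<le> (\<Sum>i = 1..j. f i)" using that anti by (intro sorted_mult_le_sum) auto
    also have "\<dots> \<le> (\<Sum>i = 1..k. f i)" using that by (intro sum_mono2) auto
    finally show 1: "j * f j \<le> lam" using lam by simp
    show "f j \<le> lam" by (rule order_trans[OF _ 1]) (use that in auto)
  qed
  \<comment> \<open>The factor 2 keeps the logarithm at least 1, as the lemmas on \<open>lev\<close>
    require.\<close>
  have ratio: "1 \<le> log 2 (2 * real lam / real (f j))" "log 2 (2 * real lam / real (f j)) \<le> real L + 1"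
    if "1 \<le> j" "j \<le> k" for j
  proof -
    have "2 \<le> 2 * real lam / real (f j)" using fle(2)[OF that] f1[OF that] by (simp add: field_simps)
    then show "1 \<le> log 2 (2 * real lam / real (f j))" by (subst le_log_iff) auto
    have "2 * real lam / real (f j) \<le> 2 * real lam / 1" using f1[OF that] by (intro divide_left_mono) auto
    also have "\<dots> \<le> 2 * 2 ^ L"
    proof -
      have "real lam \<le> real (2 ^ L)" using lam(2) by (simp only: of_nat_le_iff)
      then show ?thesis by simp
    qed
    finally have "2 * real lam / real (f j) \<le> 2 powr (real L + 1)"
      by (simp add: powr_add powr_realpow mult.commute)
    moreover have "0 < 2 * real lam / real (f j)" using fle(2)[OF that] f1[OF that] by auto
    ultimately show "log 2 (2 * real lam / real (f j)) \<le> real L + 1"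
      by (subst log_le_iff) auto
  qed
  have cls_mono: "cls i \<le> cls j" if "1 \<le> i" "i \<le> j" "j \<le> k" for i j
  proof -
    have "2 * real lam / real (f i) \<le> 2 * real lam / real (f j)"
      using that anti[of i j] f1[of i] f1[of j] by (intro divide_left_mono) auto
    moreover have "0 < 2 * real lam / real (f i)" using that fle(2)[of i] f1[of i] by auto
    ultimately show ?thesis unfolding cls_def using ratio[of i] that D0
      by (intro lev_mono) auto
  qed
  have nn1: "1 \<le> nn g" for g
  proof -
    have "2 powr 1 \<le> (2::real) powr geo D g" using geo_ge_1 by (intro powr_mono) auto
    then show ?thesis unfolding nn_def by simp linarith
  qed
  have nn_le: "nn g \<le> y \<longleftrightarrow> 2 powr geo D g \<le> real y + 1" for g y
    unfolding nn_def by linarith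
  have nn_mono: "nn g \<le> nn g'" if "g \<le> g'" for g g'
    unfolding nn_def using geo_mono[OF that, of D] by (intro diff_le_mono nat_mono ceiling_mono powr_mono) auto
  have L1: "1 \<le> log 2 (real j + 1)" if "1 \<le> j" for j :: nat
    using that by (subst le_log_iff) auto
  have "\<exists>A \<subseteq> {..2 * max_lev D L}. \<forall>g \<le> max_lev D L. prof A g = \<tau> g"
  proof (rule ex_prof)
    show "\<tau> g \<le> \<tau> g'" if "g \<le> g'" for g g'
      unfolding \<tau>_def using nn1[of g] nn1[of g'] nn_mono[OF that] False by (intro cls_mono) auto
    show "\<tau> g \<le> max_lev D L" for g
      unfolding \<tau>_def cls_def using ratio[of "min (nn g) k"] D0 nn1[of g] False
      by (intro lev_le_max_lev) auto
  qed
  then obtain A where A: "A \<subseteq> {..2 * max_lev D L}" "\<And>g. g \<le> max_lev D L \<Longrightarrow> prof A g = \<tau> g"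
    by blast
  have phi: "1 \<le> \<phi> j" "\<phi> j \<le> j" if "1 \<le> j" for j
  proof -
    show "1 \<le> \<phi> j" unfolding \<phi>_def by (rule nn1)
    have "geo D (\<gamma> j) \<le> log 2 (real j + 1)" unfolding \<gamma>_def using L1[OF that] D0 by (intro geo_lev_le)
    then show "\<phi> j \<le> j" unfolding \<phi>_def nn_le by (subst (asm) le_log_iff) auto
  qed
  have sw: "slot_weight D A j = weight D (cls (\<phi> j))" if "1 \<le> j" "j \<le> k" for j
  proof -
    \<comment> \<open>Every child contains a node, so ranks stay below \<open>2 ^ L\<close> and
      their levels are all recorded.\<close>
    have "real j + 1 \<le> 2 ^ L * 1"
    proof -
      have "j * 1 \<le> (\<Sum>i = 1..k. f i)"
        using that f1 fle sum_mono[of "{1..k}" "\<lambda>_. 1" f] by simp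
      then have "j + 1 \<le> 2 ^ L" using lam by linarith
      then have "real (j + 1) \<le> real (2 ^ L)" by (simp only: of_nat_le_iff)
      then show ?thesis by simp
    qed
    then have "log 2 (real j + 1) \<le> real L"
      by (subst log_le_iff) (auto simp: powr_realpow)
    then have "\<gamma> j \<le> max_lev D L" unfolding \<gamma>_def using L1[of j] that D0
      by (intro lev_le_max_lev) auto
    then show ?thesis unfolding slot_weight_def \<gamma>_def[symmetric] using A(2)[of "\<gamma> j"] phi[of j] that
      by (simp add: \<tau>_def \<phi>_def[symmetric])
  qed
  have "(\<Sum>j = 1..k. slot_weight D A j) = (\<Sum>j = 1..k. weight D (cls (\<phi> j)))"
    by (intro sum.cong refl sw) auto
  also have "\<dots> \<le> (\<Sum>j = 1..k. (real j + 1) powr (3 * (1 / real D)) * weight D (cls j))"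
  proof (rule sum_antimono_compose_le)
    fix y assume y: "1 \<le> y" "y \<le> k"
    \<comment> \<open>Within one level \<open>log 2 (j + 1)\<close> grows by a factor below
      \<open>1 + 1 / D\<close>, so \<open>j + 1\<close> stays below that power of
      \<open>y + 1\<close>.\<close>
    have "real j \<le> (real y + 1) powr (1 + 1 / real D) - 1" if "j \<in> {1..k}" "\<phi> j \<le> y" for j
    proof -
      have "log 2 (real j + 1) < geo D (Suc (\<gamma> j))" unfolding \<gamma>_def
        using L1[of j] that D0 by (intro less_geo_Suc_lev) auto
      then have "real j + 1 < 2 powr (geo D (\<gamma> j) * (1 + 1 / real D))"
        unfolding geo_Suc by (subst (asm) log_less_iff) auto
      also have "\<dots> = (2 powr geo D (\<gamma> j)) powr (1 + 1 / real D)" by (simp add: powr_powr)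
      also have "\<dots> \<le> (real y + 1) powr (1 + 1 / real D)"
        using that(2) unfolding \<phi>_def nn_le by (intro powr_mono2) auto
      finally show ?thesis by simp
    qed
    then have "j \<le> nat \<lfloor>(real y + 1) powr (1 + 1 / real D) - 1\<rfloor>" if "j \<in> {1..k}" "\<phi> j \<le> y" for j
      using that by (intro le_nat_floor) blast
    then have "{j \<in> {1..k}. \<phi> j \<le> y} \<subseteq> {1..nat \<lfloor>(real y + 1) powr (1 + 1 / real D) - 1\<rfloor>}"
      by fastforce
    from card_mono[OF finite_atLeastAtMost this]
    have "card {j \<in> {1..k}. \<phi> j \<le> y} \<le> nat \<lfloor>(real y + 1) powr (1 + 1 / real D) - 1\<rfloor>"
      by simp
    moreover have "1 powr (1 + 1 / real D) \<le> (real y + 1) powr (1 + 1 / real D)"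
      by (intro powr_mono2) auto
    ultimately have "real (card {j \<in> {1..k}. \<phi> j \<le> y}) \<le> (real y + 1) powr (1 + 1 / real D) - 1"
      by simp linarith
    also have "\<dots> \<le> (\<Sum>j = 1..y. (real j + 1) powr (3 * (1 / real D)))"
      by (intro sum_powr_ge) auto
    finally show "real (card {j \<in> {1..k}. \<phi> j \<le> y}) \<le> \<dots>" .
  next
    fix j assume "1 \<le> j" "j \<le> k"
    then show "1 \<le> \<phi> j \<and> \<phi> j \<le> k" using phi[of j] by simp
  next
    fix i j assume "1 \<le> i" "i \<le> j" "j \<le> k"
    then show "weight D (cls j) \<le> weight D (cls i)" by (intro weight_antimono cls_mono)
  qed (simp add: weight_pos less_imp_le)
  also have "\<dots> \<le> (\<Sum>j = 1..k. real (f j) / real lam)"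
  proof (rule sum_mono)
    fix j assume "j \<in> {1..k}"
    then have j: "1 \<le> j" "j \<le> k" by auto
    show "(real j + 1) powr (3 * (1 / real D)) * weight D (cls j) \<le> real (f j) / real lam"
    proof (rule weight_le[OF D])
      show "log 2 (2 * real lam / real (f j)) < geo D (Suc (cls j))" unfolding cls_def
        using ratio[OF j] D0 by (intro less_geo_Suc_lev) auto
      show "real j * real (f j) \<le> real lam" using fle(1)[OF j] by (simp flip: of_nat_mult)
    qed (use f1[OF j] fle(2)[OF j] j in auto)
  qed
  also have "\<dots> = real (\<Sum>j = 1..k. f j) / real lam" by (simp add: sum_divide_distrib)
  also have "\<dots> \<le> 1"
  proof -
    have "(\<Sum>j = 1..k. f j) \<le> lam" using lam by simp
    then have "real (\<Sum>j = 1..k. f j) \<le> real lam" by (simp only: of_nat_le_iff)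
    then show ?thesis by (rule divide_le_eq_1[THEN iffD2, OF disjI1, OF conjI, rotated]) (use lam in simp)
  qed
  finally have "(\<Sum>j = 1..k. slot_weight D A j) \<le> 1" .
  moreover have "weight D (cls j) \<le> slot_weight D A j" if "1 \<le> j" "j \<le> k" for j
    unfolding sw[OF that] using phi[of j] that by (intro weight_antimono cls_mono) auto
  ultimately show ?thesis using A(1) unfolding cls_def by blast
qed

text \<open>Here \<open>lam\<close> counts a node with its light subtrees, and the block gets the
  room that \<open>cap_diff\<close> leaves beside the heavy child. The factor
  \<open>1 + 1 / D\<close> in each slot allows for the rounded window length that \<open>hop\<close>
  reads.\<close>

lemma ex_slots:
  fixes f :: "nat \<Rightarrow> nat"
  assumes D: "D \<ge> 4"
    and anti: "\<And>i j. 1 \<le> i \<Longrightarrow> i \<le> j \<Longrightarrow> j \<le> k \<Longrightarrow> f j \<le> f i"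
    and f1: "\<And>j. 1 \<le> j \<Longrightarrow> j \<le> k \<Longrightarrow> 1 \<le> f j \<and> 2 * f j \<le> s"
    and lam: "1 + (\<Sum>j = 1..k. f j) \<le> lam" "lam \<le> s" "s \<le> 2 ^ L"
  shows "\<exists>e A. A \<subseteq> {..2 * max_lev D L} \<and> real e \<le> real D * log 2 (cap D s) \<and>
    real (blk D e) \<le> 2 * real D * real lam * real s powr (32 / real D) \<and>
    (\<forall>j. 1 \<le> j \<and> j \<le> k \<longrightarrow>
      real (off D e A j) + (1 + 1 / real D) * cap D (f j) \<le> real (off D e A (Suc j))) \<and>
    off D e A (Suc k) \<le> blk D e"
proof -
  define d where "d = 1 / real D"
  have d: "0 < d" "d \<le> 1/4" using D by (auto simp: d_def field_simps)
  obtain A where A: "A \<subseteq> {..2 * max_lev D L}" "(\<Sum>j = 1..k. slot_weight D A j) \<le> 1"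
    "\<And>j. 1 \<le> j \<Longrightarrow> j \<le> k \<Longrightarrow> weight D (lev D (log 2 (2 * real lam / real (f j)))) \<le> slot_weight D A j"
    using ex_profile[OF D anti _ lam(1) order_trans[OF lam(2,3)]] f1 by blast
  define c where "c = 2 * real D * real lam * real s powr (32 / real D)"
  have s1: "real s powr (32 / real D) \<ge> 1" using lam(1,2) D by (intro ge_one_powr_ge_zero) auto
  have lam1: "real lam \<ge> 1" using lam(1) by simp
  have cD: "c \<ge> 2 * real D"
  proof -
    have "2 * real D * 1 * 1 \<le> c" unfolding c_def using s1 lam1 by (intro mult_mono) auto
    then show ?thesis by simp
  qed
  have c3: "c \<ge> 8" using cD D by simp
  \<comment> \<open>Subtracting 2 pays for the ceiling and the added 1 in
    \<open>blk\<close>.\<close>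
  define e where "e = lev D (c - 2)"
  have e_le: "geo D e \<le> c - 2" unfolding e_def using c3 D by (intro geo_lev_le) auto
  have e_ge: "c - 2 < geo D e * (1 + d)"
    using less_geo_Suc_lev[of D "c - 2"] c3 D unfolding geo_Suc e_def d_def by simp
  have "real e \<le> real D * log 2 (cap D s)"
  proof -
    have "real e \<le> real D * log 2 (c - 2)" unfolding e_def using c3 D by (intro lev_le) auto
    also have "\<dots> \<le> real D * log 2 (cap D s)"
    proof (intro mult_left_mono)
      have "c \<le> 2 * real D * real s * real s powr (32 / real D)"
        unfolding c_def using lam by (intro mult_mono) auto
      also have "\<dots> = cap D s" unfolding cap_def using lam lam1 by (simp add: powr_add)
      finally show "log 2 (c - 2) \<le> log 2 (cap D s)" using c3 by simp
    qed simp
    finally show ?thesis .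
  qed
  moreover have "real (blk D e) \<le> c"
    unfolding blk_def using e_le geo_pos[of D e] by linarith
  moreover have "real (off D e A j) + (1 + d) * cap D (f j) \<le> real (off D e A (Suc j))"
    if j: "1 \<le> j" "j \<le> k" for j
  proof -
    define t where "t = lev D (log 2 (2 * real lam / real (f j)))"
    have flam: "f j \<le> lam"
    proof -
      have "f j \<le> (\<Sum>j = 1..k. f j)" using j by (intro member_le_sum) auto
      then show ?thesis using lam by simp
    qed
    have "2 \<le> 2 * real lam / real (f j)" using flam f1[OF j] by (simp add: field_simps)
    then have "1 \<le> log 2 (2 * real lam / real (f j))" by (subst le_log_iff) auto
    then have "geo D t \<le> log 2 (2 * real lam / real (f j))" unfolding t_def using D
      by (intro geo_lev_le) auto
    then have "2 powr (10 / real D) * real (f j) powr (1 + 32 / real D) \<le>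
        weight D t * (real lam * real s powr (32 / real D))"
      using f1[OF j] flam lam D by (intro weight_ge) (auto simp flip: of_nat_mult)
    also have "\<dots> \<le> slot_weight D A j * (real lam * real s powr (32 / real D))"
      using A(3)[OF j] unfolding t_def by (intro mult_right_mono) auto
    finally have w: "2 powr (10 * d) * real (f j) powr (1 + 32 / real D) \<le> \<dots>" by (simp add: d_def)
    \<comment> \<open>A share \<open>1 / D\<close> of the window thus covers the position lost to
      the floor in \<open>off\<close>.\<close>
    have cap1: "cap D (f j) * d \<ge> 1"
    proof -
      have "real (f j) powr (1 + 32 / real D) \<ge> 1" using f1[OF j] by (intro ge_one_powr_ge_zero) auto
      moreover have "cap D (f j) * d = 2 * real (f j) powr (1 + 32 / real D)" using D
        by (simp add: cap_def d_def)
      ultimately show ?thesis by simp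
    qed
    have wpos: "0 \<le> slot_weight D A j" by (simp add: slot_weight_def weight_pos less_imp_le)
    have M: "c * ((1 - d) / (1 + d)) \<le> geo D e"
    proof -
      have "2 \<le> c * d" using cD D by (simp add: d_def field_simps)
      then have "c * (1 - d) \<le> geo D e * (1 + d)" using e_ge by (simp add: algebra_simps)
      then show ?thesis using d by (simp add: field_simps)
    qed
    have "(1 + d) * cap D (f j) + 1 \<le> (1 + 2 * d) * cap D (f j)"
      using cap1 by (simp add: algebra_simps)
    \<comment> \<open>The inserted factors cancel and bring the losses into the form of
      \<open>slack_le\<close>.\<close>
    also have "\<dots> = ((1 + 2 * d) * (1 + d) / (1 - d)) * cap D (f j) * ((1 - d) / (1 + d))"
    proof -
      have "1 - d \<noteq> 0" "1 + d \<noteq> 0" using d by auto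
      then show ?thesis by simp
    qed
    also have "\<dots> \<le> 2 powr (10 * d) * cap D (f j) * ((1 - d) / (1 + d))"
      using slack_le[OF D] d unfolding d_def[symmetric]
      by (intro mult_right_mono) (auto simp: cap_def)
    also have "\<dots> = 2 * real D * (2 powr (10 * d) * real (f j) powr (1 + 32 / real D)) * ((1 - d) / (1 + d))"
      by (simp add: cap_def)
    also have "\<dots> \<le> 2 * real D * (slot_weight D A j * (real lam * real s powr (32 / real D))) * ((1 - d) / (1 + d))"
      using w d by (intro mult_right_mono mult_left_mono) auto
    also have "\<dots> = slot_weight D A j * (c * ((1 - d) / (1 + d)))" by (simp add: c_def)
    also have "\<dots> \<le> slot_weight D A j * geo D e" by (intro mult_left_mono M wpos)
    finally show ?thesis using off_Suc_ge[OF j(1), of D e A] by (simp add: mult.commute)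
  qed
  moreover have "off D e A (Suc k) \<le> blk D e"
  proof -
    have "geo D e * (\<Sum>i = 1..<Suc k. slot_weight D A i) \<le> geo D e * 1"
      using A(2) geo_pos[of D e] by (intro mult_left_mono) (auto simp: atLeastLessThanSuc_atLeastAtMost)
    then have "nat \<lfloor>geo D e * (\<Sum>i = 1..<Suc k. slot_weight D A i)\<rfloor> \<le> nat \<lceil>geo D e\<rceil>" by linarith
    then show ?thesis unfolding off_def blk_def by linarith
  qed
  ultimately show ?thesis using A(1) unfolding d_def c_def by blast
qed

subsection \<open>Rooted trees and canonical ports\<close>

text \<open>Elements enter in order of decreasing \<open>key\<close>, and each new one receives the
  next number.\<close>

lemma ex_antimono_ranking:
  fixes key :: "nat \<Rightarrow> nat"
  assumes "finite S"
  shows "\<exists>\<pi>. bij_betw \<pi> S {1..card S} \<and> (\<forall>a\<in>S. \<forall>b\<in>S. key b < key a \<longrightarrow> \<pi> a < (\<pi> b :: nat))"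
  using assms
proof (induction S rule: finite_ranking_induct[where f = "\<lambda>c. - int (key c)"])
  case (insert x S)
  show ?case
  proof (cases "x \<in> S")
    case True
    then show ?thesis using insert by (simp add: insert_absorb)
  next
    case False
    obtain \<pi> where \<pi>: "bij_betw \<pi> S {1..card S}"
      "\<And>a b. a \<in> S \<Longrightarrow> b \<in> S \<Longrightarrow> key b < key a \<Longrightarrow> \<pi> a < \<pi> b"
      using insert by blast
    let ?\<pi> = "\<pi>(x := Suc (card S))"
    have "bij_betw ?\<pi> S {1..card S}" using \<pi>(1) False by (subst bij_betw_cong[of _ _ \<pi>]) auto
    then have "bij_betw ?\<pi> (S \<union> {x}) ({1..card S} \<union> {?\<pi> x})"
      by (subst notIn_Un_bij_betw3[symmetric]) (use False in auto)
    moreover have "{1..card S} \<union> {?\<pi> x} = {1..card (insert x S)}"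
      using False insert by auto
    moreover have "\<pi> a < Suc (card S)" if "a \<in> S" for a
      using bij_betwE[OF \<pi>(1)] that by fastforce
    moreover have "\<not> key a < key x" if "a \<in> S" for a using insert.hyps(2)[OF that] by simp
    ultimately have "bij_betw ?\<pi> (insert x S) {1..card (insert x S)} \<and>
      (\<forall>a\<in>insert x S. \<forall>b\<in>insert x S. key b < key a \<longrightarrow> ?\<pi> a < ?\<pi> b)"
      using False \<pi>(2) by (simp del: One_nat_def)
    then show ?thesis by blast
  qed
qed auto

text \<open>Each child has one parent, so the rankings at all nodes merge into one function that
  looks up the parent.\<close>

lemma ex_canonical_ports: "\<exists>port. canonical_ports n r p port"
proof -
  have "\<exists>\<pi>. bij_betw \<pi> (children n r p v) {1..card (children n r p v)} \<and>
    (\<forall>a\<in>children n r p v. \<forall>b\<in>children n r p v.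
       card (subtree n p b) < card (subtree n p a) \<longrightarrow> \<pi> a < (\<pi> b :: nat))" for v
    by (rule ex_antimono_ranking) (simp add: children_def)
  then obtain \<pi> where \<pi>: "\<And>v. bij_betw (\<pi> v) (children n r p v) {1..card (children n r p v)}"
    "\<And>v a b. a \<in> children n r p v \<Longrightarrow> b \<in> children n r p v \<Longrightarrow>
       card (subtree n p b) < card (subtree n p a) \<Longrightarrow> \<pi> v a < (\<pi> v b :: nat)"
    by metis
  have par: "p c = v" if "c \<in> children n r p v" for c v using that by (simp add: children_def)
  have "bij_betw (\<lambda>c. \<pi> (p c) c) (children n r p v) {1..card (children n r p v)}" for v
  proof -
    have "bij_betw (\<lambda>c. \<pi> (p c) c) (children n r p v) {1..card (children n r p v)} =
      bij_betw (\<pi> v) (children n r p v) {1..card (children n r p v)}"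
      by (rule bij_betw_cong) (simp add: par)
    then show ?thesis using \<pi>(1) by (simp only:)
  qed
  then have "canonical_ports n r p (\<lambda>c. \<pi> (p c) c)"
    unfolding canonical_ports_def valid_ports_def using \<pi>(2) par by metis
  then show ?thesis by blast
qed

section \<open>Ancestors, subtrees and their sizes\<close>

locale tree =
  fixes n r :: nat and p :: "nat \<Rightarrow> nat"
  assumes rooted: "rooted_tree n r p"
begin

lemma root: "r < n" "p r = r"
  using rooted by (auto simp: rooted_tree_def)

lemma parent_less: "v < n \<Longrightarrow> p v < n"
  using rooted by (auto simp: rooted_tree_def)

lemma reaches_root: "v < n \<Longrightarrow> \<exists>k. (p ^^ k) v = r"
  using rooted by (auto simp: rooted_tree_def)

definition depth :: "nat \<Rightarrow> nat" where
  "depth v = (LEAST k. (p ^^ k) v = r)"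

lemma funpow_less: "v < n \<Longrightarrow> (p ^^ k) v < n"
  by (induction k) (auto simp: parent_less)

lemma depth_root: "depth r = 0"
  unfolding depth_def by (rule Least_eq_0) simp

lemma depth_parent:
  assumes "v < n" "v \<noteq> r"
  shows "depth v = Suc (depth (p v))"
proof -
  obtain k where "(p ^^ k) v = r" using reaches_root assms by blast
  then have "(LEAST k. (p ^^ k) v = r) = Suc (LEAST k. (p ^^ Suc k) v = r)"
    by (rule Least_Suc) (use assms in simp)
  then show ?thesis unfolding depth_def by (simp add: funpow_swap1)
qed

text \<open>Truncated subtraction includes the root, which is its own parent.\<close>

lemma depth_parent_diff: "v < n \<Longrightarrow> depth (p v) = depth v - 1"
  using depth_parent depth_root root by (cases "v = r") auto

lemma depth_funpow: "v < n \<Longrightarrow> depth ((p ^^ k) v) = depth v - k"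
  by (induction k) (auto simp: depth_parent_diff funpow_less)

abbreviation ch where "ch \<equiv> children n r p"
abbreviation sub where "sub \<equiv> subtree n p"

definition sz :: "nat \<Rightarrow> nat" where "sz v = card (sub v)"

lemma childD: assumes "c \<in> ch v" shows "c < n" "c \<noteq> r" "p c = v" "v < n" "depth c = Suc (depth v)"
  using assms parent_less[of c] depth_parent[of c] by (auto simp: children_def)

lemma finite_ch: "finite (ch v)"
  by (simp add: children_def)

lemma finite_sub: "finite (sub v)"
  by (simp add: subtree_def)

lemma sub_refl: "v < n \<Longrightarrow> v \<in> sub v"
  unfolding subtree_def by (auto intro: exI[of _ 0])

lemma sub_less: "w \<in> sub v \<Longrightarrow> w < n"
  by (simp add: subtree_def)

lemma sub_root: "w < n \<Longrightarrow> w \<in> sub r"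
  using reaches_root by (simp add: subtree_def)

lemma sub_parent: "w \<in> sub c \<Longrightarrow> w \<in> sub (p c)"
  unfolding subtree_def by (auto intro: exI[of _ "Suc _"])

lemma sub_child: "c \<in> ch v \<Longrightarrow> sub c \<subseteq> sub v"
  using sub_parent childD by blast

text \<open>The child is the last node before \<open>v\<close> on the way up from \<open>w\<close>.
  It is not the root: \<open>p\<close> fixes the root, so \<open>v\<close> would have been reached
  earlier, against the choice of \<open>k\<close>.\<close>

lemma sub_cases:
  assumes "w \<in> sub v" "w \<noteq> v"
  obtains c where "c \<in> ch v" "w \<in> sub c"
proof -
  define k where "k = (LEAST k. (p ^^ k) w = v)"
  have k: "(p ^^ k) w = v" unfolding k_def using assms(1) by (auto simp: subtree_def intro: LeastI)
  with assms(2) obtain m where m: "k = Suc m" by (cases k) auto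
  have w: "w < n" using assms sub_less by blast
  have "(p ^^ m) w \<noteq> v" using not_less_Least[of m "\<lambda>k. (p ^^ k) w = v"] m unfolding k_def by auto
  then have "(p ^^ m) w \<noteq> r" using k m root by auto
  then have "(p ^^ m) w \<in> ch v" using k m w funpow_less by (auto simp: children_def)
  moreover have "w \<in> sub ((p ^^ m) w)" using w by (auto simp: subtree_def)
  ultimately show thesis by (rule that)
qed

lemma depth_sub: "w \<in> sub v \<Longrightarrow> depth v \<le> depth w"
  by (auto simp: subtree_def depth_funpow)

lemma not_in_sub_child: "c \<in> ch v \<Longrightarrow> v \<notin> sub c"
  using depth_sub[of v c] childD(5)[of c v] by auto

text \<open>Both ancestors have depth \<open>depth v + 1\<close>, and this depth fixes the number of
  steps from \<open>w\<close>.\<close>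

lemma child_unique:
  assumes "c \<in> ch v" "c' \<in> ch v" "w \<in> sub c" "w \<in> sub c'"
  shows "c = c'"
proof -
  obtain i j where ij: "(p ^^ i) w = c" "(p ^^ j) w = c'" "w < n"
    using assms by (auto simp: subtree_def)
  then have "depth w - i = Suc (depth v)" "depth w - j = Suc (depth v)"
    using depth_funpow[of w] childD(5) assms by metis+
  then have "i = j" by linarith
  then show ?thesis using ij by simp
qed

lemma sz_pos: "v < n \<Longrightarrow> 1 \<le> sz v"
  unfolding sz_def using sub_refl finite_sub by (metis Suc_leI card_gt_0_iff empty_iff One_nat_def)

lemma sz_le: "sz v \<le> n"
  unfolding sz_def using card_mono[of "{..<n}" "sub v"] by (auto simp: subtree_def)

lemma sz_eq:
  assumes "v < n" shows "sz v = 1 + (\<Sum>c\<in>ch v. sz c)"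
proof -
  have "sub v = insert v (\<Union>c\<in>ch v. sub c)"
  proof (intro equalityI subsetI)
    fix w assume "w \<in> sub v"
    then show "w \<in> insert v (\<Union>c\<in>ch v. sub c)" using sub_cases[of w v] by (cases "w = v") auto
  next
    fix w assume "w \<in> insert v (\<Union>c\<in>ch v. sub c)"
    then show "w \<in> sub v" using sub_child[of _ v] sub_refl[OF assms] by auto
  qed
  moreover have "v \<notin> (\<Union>c\<in>ch v. sub c)" using not_in_sub_child by blast
  moreover have "card (\<Union>c\<in>ch v. sub c) = (\<Sum>c\<in>ch v. sz c)"
    unfolding sz_def
  proof (rule card_UN_disjoint)
    show "\<forall>i\<in>ch v. \<forall>j\<in>ch v. i \<noteq> j \<longrightarrow> sub i \<inter> sub j = {}"
      using child_unique[of _ v] by (meson disjoint_iff)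
  qed (auto simp: finite_ch finite_sub)
  ultimately show ?thesis unfolding sz_def using finite_ch finite_sub by simp
qed

lemma route_answer_child:
  assumes "c \<in> ch u" "w \<in> sub c"
  shows "route_answer n r p port u w = port c"
proof -
  have "(THE c. c \<in> ch u \<and> w \<in> sub c) = c" using assms child_unique by blast
  then show ?thesis unfolding route_answer_def using assms sub_child by auto
qed

end

section \<open>Window lengths and the parameters of one node\<close>

lemma cap_mono: "0 \<le> s \<Longrightarrow> s \<le> t \<Longrightarrow> cap D s \<le> cap D t"
  unfolding cap_def by (intro mult_left_mono powr_mono2) auto

text \<open>Split the linear factor \<open>a + b\<close> and use
  \<open>a powr (32 / D) \<le> (a + b) powr (32 / D)\<close>. With \<open>a\<close> the heavy
  subtree and \<open>b\<close> the rest, this is the room for the block.\<close>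

lemma cap_diff:
  assumes "0 \<le> a" "0 < b"
  shows "2 * real D * b * (a + b) powr (32 / real D) + cap D a \<le> cap D (a + b)"
proof -
  have "a powr (1 + 32 / real D) \<le> a * (a + b) powr (32 / real D)"
  proof (cases "a = 0")
    case False
    then have "a powr (1 + 32 / real D) = a * a powr (32 / real D)" using assms by (simp add: powr_add)
    also have "\<dots> \<le> a * (a + b) powr (32 / real D)"
      using assms by (intro mult_left_mono powr_mono2) auto
    finally show ?thesis .
  qed simp
  then have "cap D a \<le> 2 * real D * (a * (a + b) powr (32 / real D))"
    unfolding cap_def by (intro mult_left_mono) auto
  moreover have "cap D (a + b) = 2 * real D * ((a + b) * (a + b) powr (32 / real D))"
    unfolding cap_def using assms by (simp add: powr_add)
  ultimately show ?thesis by (simp add: algebra_simps)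
qed

locale ported_tree = tree +
  fixes port :: "nat \<Rightarrow> nat" and D L :: nat
  assumes canonical: "canonical_ports n r p port" and D4: "D \<ge> 4" and n_le: "n \<le> 2 ^ L"
begin

lemma port_bij: "v < n \<Longrightarrow> bij_betw port (ch v) {1..card (ch v)}"
  using canonical by (simp add: canonical_ports_def valid_ports_def)

lemma port_inj: "a \<in> ch v \<Longrightarrow> b \<in> ch v \<Longrightarrow> port a = port b \<Longrightarrow> a = b"
  using port_bij[of v] childD(4) by (auto simp: bij_betw_def inj_on_def)

lemma port_range: "a \<in> ch v \<Longrightarrow> 1 \<le> port a \<and> port a \<le> card (ch v)"
  using bij_betwE[OF port_bij[of v]] childD(4) by fastforce

lemma port_sz:
  assumes "a \<in> ch v" "b \<in> ch v" "port a \<le> port b" shows "sz b \<le> sz a"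
proof (rule ccontr)
  assume "\<not> ?thesis"
  then have "port b < port a" using canonical assms childD(4)
    unfolding canonical_ports_def sz_def by (meson not_le)
  then show False using assms by simp
qed

lemma ex_node_params:
  assumes v: "v < n"
  shows "\<exists>e A. A \<subseteq> {..2 * max_lev D L} \<and> real e \<le> real D * log 2 (cap D (sz v)) \<and>
    real (blk D e) \<le> cap D (sz v) \<and>
    (\<forall>c\<in>ch v. port c = 1 \<longrightarrow> real (blk D e) + cap D (sz c) \<le> cap D (sz v)) \<and>
    (\<forall>c\<in>ch v. port c > 1 \<longrightarrow> off D e A (port c) \<le> blk D e \<and>
      real (off D e A (port c - 1)) + (1 + 1 / real D) * cap D (sz c) \<le> real (off D e A (port c)))"
proof -
  define child where "child = inv_into (ch v) port"
  \<comment> \<open>Truncated subtraction gives \<open>k = 0\<close> at a leaf, where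
    \<open>hv\<close> is 0 as well.\<close>
  define k where "k = card (ch v) - 1"
  define f where "f j = sz (child (Suc j))" for j
  define hv where "hv = (if ch v = {} then 0 else sz (child 1))"
  define lam where "lam = sz v - hv"
  have child: "child j \<in> ch v" "port (child j) = j" if "1 \<le> j" "j \<le> card (ch v)" for j
    using that bij_betw_imp_surj_on[OF port_bij[OF v]] unfolding child_def
    by (auto intro: inv_into_into f_inv_into_f)
  have child_port: "child (port c) = c" if "c \<in> ch v" for c
    using port_bij[OF v] that unfolding child_def by (auto simp: bij_betw_def)
  have bij: "bij_betw child {1..card (ch v)} (ch v)"
    unfolding child_def by (rule bij_betw_inv_into[OF port_bij[OF v]])
  have split: "sz v = 1 + hv + (\<Sum>j = 1..k. f j)"
  proof -
    have "(\<Sum>c\<in>ch v. sz c) = (\<Sum>j = 1..card (ch v). sz (child j))"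
      by (rule sum.reindex_bij_betw[OF bij, symmetric])
    also have "\<dots> = hv + (\<Sum>j = 1..k. f j)"
    proof (cases "ch v = {}")
      case False
      then have "card (ch v) = Suc k" using finite_ch[of v] card_gt_0_iff[of "ch v"] unfolding k_def by simp
      then show ?thesis using False unfolding hv_def f_def
        by (simp add: sum.atLeast_Suc_atMost sum.shift_bounds_cl_Suc_ivl del: sum.cl_ivl_Suc)
    qed (simp add: hv_def k_def)
    finally show ?thesis using sz_eq[OF v] by simp
  qed
  have sz_v: "sz v = hv + lam" "lam = 1 + (\<Sum>j = 1..k. f j)" using split by (auto simp: lam_def)
  have k1: "1 \<le> Suc j" "Suc j \<le> card (ch v)" if "j \<le> k" "1 \<le> j" for j using that by (auto simp: k_def)
  have "\<exists>e A. A \<subseteq> {..2 * max_lev D L} \<and> real e \<le> real D * log 2 (cap D (sz v)) \<and>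
    real (blk D e) \<le> 2 * real D * real lam * real (sz v) powr (32 / real D) \<and>
    (\<forall>j. 1 \<le> j \<and> j \<le> k \<longrightarrow>
      real (off D e A j) + (1 + 1 / real D) * cap D (f j) \<le> real (off D e A (Suc j))) \<and>
    off D e A (Suc k) \<le> blk D e"
  proof (rule ex_slots[OF D4])
    fix i j assume ij: "1 \<le> i" "i \<le> j" "j \<le> k"
    then show "f j \<le> f i" unfolding f_def
      using child[of "Suc i"] child[of "Suc j"] k1[of i] k1[of j] by (intro port_sz[of _ v]) auto
  next
    fix j assume j: "1 \<le> j" "j \<le> k"
    then have ne: "1 \<le> card (ch v)" "ch v \<noteq> {}" by (auto simp: k_def)
    \<comment> \<open>Port 1 belongs to a largest child, so a light child has at most half of the
      nodes.\<close>
    have "f j \<le> hv" unfolding f_def hv_def using child[of "Suc j"] child[of 1] k1[of j] j ne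
      by (auto intro!: port_sz[of _ v])
    moreover have "f j \<le> (\<Sum>j = 1..k. f j)" using j by (intro member_le_sum) auto
    moreover have "1 \<le> f j" unfolding f_def using child[of "Suc j"] k1[of j] j sz_pos childD(1) by blast
    ultimately show "1 \<le> f j \<and> 2 * f j \<le> sz v" using split by linarith
  next
    show "sz v \<le> 2 ^ L" using sz_le n_le order_trans by blast
  qed (use sz_v in auto)
  then obtain e A where eA: "A \<subseteq> {..2 * max_lev D L}" "real e \<le> real D * log 2 (cap D (sz v))"
    "real (blk D e) \<le> 2 * real D * real lam * real (sz v) powr (32 / real D)"
    "\<And>j. 1 \<le> j \<Longrightarrow> j \<le> k \<Longrightarrow>
      real (off D e A j) + (1 + 1 / real D) * cap D (f j) \<le> real (off D e A (Suc j))"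
    "off D e A (Suc k) \<le> blk D e" by blast
  have b: "real (blk D e) + cap D hv \<le> cap D (sz v)"
  proof -
    have "real (sz v) = real hv + real lam" using sz_v(1) by simp
    moreover have "0 < lam" using sz_v(2) by simp
    ultimately show ?thesis using eA(3) cap_diff[of "real hv" "real lam" D] by simp
  qed
  moreover have "0 \<le> cap D hv" by (simp add: cap_def)
  moreover have "sz c = hv" if "c \<in> ch v" "port c = 1" for c
    using that child_port[of c] unfolding hv_def by auto
  moreover have "off D e A (port c) \<le> blk D e \<and>
      real (off D e A (port c - 1)) + (1 + 1 / real D) * cap D (sz c) \<le> real (off D e A (port c))"
    if c: "c \<in> ch v" "port c > 1" for c
  proof -
    define j where "j = port c - 1"
    have j: "port c = Suc j" "1 \<le> j" "j \<le> k" using c port_range[of c v] by (auto simp: j_def k_def)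
    have "f j = sz c" using child_port[OF c(1)] j by (simp add: f_def)
    then show ?thesis using eA(4)[of j] j eA(5) off_mono[of "Suc j" "Suc k" D e A] by auto
  qed
  ultimately show ?thesis using eA(1,2) by (intro exI[of _ e] exI[of _ A]) auto
qed

end

subsection \<open>Positions and routing\<close>

text \<open>The argument (x, e', e, A) belongs to the source: its position x, the exponents of the
  window length and of the block of the light children, and the code of the slot widths. Slot j
  is occupied by the child with port j + 1, because port 1 is the heavy child.\<close>
definition hop :: "nat \<Rightarrow> nat \<times> nat \<times> nat \<times> nat set \<Rightarrow> nat \<Rightarrow> nat" where
  "hop D = (\<lambda>(x, e', e, A) y.
     if y < x \<or> geo D e' \<le> real y - real x then 0
     else if x + blk D e \<le> y then 1
     else 1 + (THE j. 1 \<le> j \<and> x + off D e A j \<le> y \<and> y < x + off D e A (Suc j)))"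

lemma off_pos: "1 \<le> off D e A j"
  by (simp add: off_def)

lemma the_slot:
  assumes "1 \<le> j" "off D e A j \<le> y" "y < off D e A (Suc j)"
  shows "(THE j. 1 \<le> j \<and> off D e A j \<le> y \<and> y < off D e A (Suc j)) = j"
proof (rule the_equality)
  fix i assume i: "1 \<le> i \<and> off D e A i \<le> y \<and> y < off D e A (Suc i)"
  show "i = j"
  proof (rule linorder_cases)
    assume "i < j" then show ?thesis using i assms off_mono[of "Suc i" j D e A] by simp
  next
    assume "j < i" then show ?thesis using i assms off_mono[of "Suc j" i D e A] by simp
  qed
qed (use assms in simp)

text \<open>Bounds the logarithm of the largest window: \<open>D + 1\<close> for the factor
  \<open>2 * D\<close>, and the rest for \<open>L * (1 + 32 / D)\<close>.\<close>

definition pos_bits :: "nat \<Rightarrow> nat \<Rightarrow> nat" where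
  "pos_bits D L = D + L + 32 * (L div D) + 33"

lemma cap_le_pos_bits:
  assumes "D > 0"
  shows "cap D (2 ^ L) \<le> 2 ^ pos_bits D L"
proof -
  have "real D \<le> 2 ^ D" using less_exp[of D] by (metis less_imp_le of_nat_le_iff of_nat_numeral of_nat_power)
  have "L \<le> D * (L div D) + D" using dividend_less_div_times[OF assms, of L] by (simp add: mult.commute)
  then have "real L \<le> real (D * (L div D) + D)" by (simp only: of_nat_le_iff)
  then have "real L / real D \<le> real (L div D) + 1" using assms by (simp add: divide_le_eq algebra_simps)
  then have "real L * (1 + 32 / real D) \<le> real (L + 32 * (L div D) + 32)"
  proof -
    have "real L * (1 + 32 / real D) = real L + 32 * (real L / real D)" by (simp add: algebra_simps)
    then show ?thesis using \<open>real L / real D \<le> real (L div D) + 1\<close> by simp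
  qed
  then have "2 powr (real L * (1 + 32 / real D)) \<le> 2 powr real (L + 32 * (L div D) + 32)"
    by (intro powr_mono) auto
  also have "\<dots> = 2 ^ (L + 32 * (L div D) + 32)" by (rule powr_realpow) simp
  finally have "(2 ^ L) powr (1 + 32 / real D) \<le> (2 ^ (L + 32 * (L div D) + 32) :: real)"
    by (simp add: powr_powr flip: powr_realpow)
  then have "cap D (2 ^ L) \<le> 2 * 2 ^ D * 2 ^ (L + 32 * (L div D) + 32)"
    unfolding cap_def using \<open>real D \<le> 2 ^ D\<close> by (intro mult_left_mono mult_mono) auto
  also have "\<dots> = 2 ^ pos_bits D L" by (simp add: pos_bits_def power_add)
  finally show ?thesis .
qed

section \<open>Nested windows and correctness of routing\<close>

locale placed_tree = ported_tree +
  fixes e :: "nat \<Rightarrow> nat" and A :: "nat \<Rightarrow> nat set"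
  assumes e_le: "v < n \<Longrightarrow> real (e v) \<le> real D * log 2 (cap D (sz v))"
    and blk_le: "v < n \<Longrightarrow> real (blk D (e v)) \<le> cap D (sz v)"
    and heavy: "v < n \<Longrightarrow> c \<in> ch v \<Longrightarrow> port c = 1 \<Longrightarrow>
      real (blk D (e v)) + cap D (sz c) \<le> cap D (sz v)"
    and light: "v < n \<Longrightarrow> c \<in> ch v \<Longrightarrow> port c > 1 \<Longrightarrow>
      off D (e v) (A v) (port c) \<le> blk D (e v) \<and>
      real (off D (e v) (A v) (port c - 1)) + (1 + 1 / real D) * cap D (sz c)
        \<le> real (off D (e v) (A v) (port c))"
begin

definition shift :: "nat \<Rightarrow> nat" where
  "shift c = (if port c = 1 then blk D (e (p c)) else off D (e (p c)) (A (p c)) (port c - 1))"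

definition pos :: "nat \<Rightarrow> nat" where
  "pos v = (\<Sum>i<depth v. shift ((p ^^ i) v))"

lemma pos_root: "pos r = 0"
  by (simp add: pos_def depth_root)

lemma pos_child: "c \<in> ch v \<Longrightarrow> pos c = pos v + shift c"
  unfolding pos_def using childD(3,5)[of c v] by (simp add: sum.lessThan_Suc_shift funpow_swap1 del: sum.lessThan_Suc)

lemma shift_pos: "1 \<le> shift c"
  unfolding shift_def using off_pos by (simp add: blk_def)

lemma cap_pos: "v < n \<Longrightarrow> cap D (sz v) > 0"
  using sz_pos[of v] D4 by (simp add: cap_def)

text \<open>Both the exact windows and those enlarged by \<open>1 + 1 / D\<close> nest. A light
  child fits with its enlarged window into the exact window of its parent; for the heavy child the
  enlargement may overhang into that of the parent.\<close>

lemma room_child: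
  assumes "c \<in> ch v"
  shows "real (shift c) + cap D (sz c) \<le> cap D (sz v)"
    "real (shift c) + (1 + 1 / real D) * cap D (sz c) \<le> (1 + 1 / real D) * cap D (sz v)"
proof -
  have v: "v < n" "p c = v" "c < n" using childD assms by auto
  have "1 \<le> port c" using port_range[OF assms] by simp
  then consider "port c = 1" | "port c > 1" by linarith
  then have "real (shift c) + cap D (sz c) \<le> cap D (sz v) \<and>
     real (shift c) + (1 + 1 / real D) * cap D (sz c) \<le> (1 + 1 / real D) * cap D (sz v)"
  proof cases
    case 1
    have *: "real (shift c) + cap D (sz c) \<le> cap D (sz v)"
      using heavy[OF v(1) assms 1] 1 v by (simp add: shift_def)
    then have "cap D (sz c) / real D \<le> cap D (sz v) / real D"
      by (intro divide_right_mono) auto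
    with * show ?thesis by (simp add: algebra_simps)
  next
    case 2
    have *: "real (shift c) + (1 + 1 / real D) * cap D (sz c) \<le> cap D (sz v)"
      using light[OF v(1) assms 2] blk_le[OF v(1)] 2 v by (simp add: shift_def)
    have "0 \<le> cap D (sz c) / real D" "0 \<le> cap D (sz v) / real D"
      using cap_pos[OF v(1)] cap_pos[OF v(3)] by auto
    with * show ?thesis by (simp add: algebra_simps)
  qed
  then show "real (shift c) + cap D (sz c) \<le> cap D (sz v)"
    "real (shift c) + (1 + 1 / real D) * cap D (sz c) \<le> (1 + 1 / real D) * cap D (sz v)" by auto
qed

lemma room_sub:
  assumes "w \<in> sub v"
  shows "pos v \<le> pos w \<and> pos w + cap D (sz w) \<le> pos v + cap D (sz v) \<and>
    pos w + (1 + 1 / real D) * cap D (sz w) \<le> pos v + (1 + 1 / real D) * cap D (sz v)"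
proof -
  obtain k where k: "(p ^^ k) w = v" and w: "w < n" using assms by (auto simp: subtree_def)
  have "pos ((p ^^ k) w) \<le> pos w \<and> pos w + cap D (sz w) \<le> pos ((p ^^ k) w) + cap D (sz ((p ^^ k) w)) \<and>
    pos w + (1 + 1 / real D) * cap D (sz w) \<le>
      pos ((p ^^ k) w) + (1 + 1 / real D) * cap D (sz ((p ^^ k) w))"
  proof (induction k)
    case (Suc k)
    define c where "c = (p ^^ k) w"
    have c: "c < n" using w funpow_less by (simp add: c_def)
    show ?case
    proof (cases "c = r")
      case True
      then show ?thesis using Suc root unfolding c_def by simp
    next
      case False
      then have "c \<in> ch (p c)" using c by (simp add: children_def)
      from room_child[OF this] pos_child[OF this] Suc show ?thesis
        unfolding c_def[symmetric] by (simp add: c_def[symmetric])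
    qed
  qed simp
  then show ?thesis unfolding k .
qed

lemma siblings_apart:
  assumes c: "c \<in> ch v" and c': "c' \<in> ch v" and lt: "port c < port c'" "port c' > 1"
    and ne: "port c \<noteq> 1"
  shows "pos c + (1 + 1 / real D) * cap D (sz c) \<le> pos c'"
proof -
  have v: "v < n" "p c = v" "p c' = v" using childD c c' by auto
  have pc: "1 < port c" using port_range[OF c] ne by linarith
  have "off D (e v) (A v) (port c) \<le> off D (e v) (A v) (port c' - 1)" using lt by (intro off_mono) simp
  then show ?thesis using light[OF v(1) c pc] pos_child[OF c] pos_child[OF c'] pc lt v
    by (simp add: shift_def)
qed

text \<open>The heavy child comes last among its siblings, so its overhang meets none of
  them.\<close>

lemma light_before_heavy:
  assumes c: "c \<in> ch v" and c': "c' \<in> ch v" and h: "port c \<noteq> 1" "port c' = 1"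
  shows "pos c + (1 + 1 / real D) * cap D (sz c) \<le> pos c'"
proof -
  have v: "v < n" "p c = v" "p c' = v" using childD c c' by auto
  have pc: "1 < port c" using port_range[OF c] h by linarith
  show ?thesis using light[OF v(1) c pc] pos_child[OF c] pos_child[OF c'] pc h v
    by (simp add: shift_def)
qed

text \<open>Consider the lowest ancestor of \<open>u\<close> whose subtree contains
  \<open>w\<close>. If it is \<open>w\<close>, it lies before \<open>u\<close>. Otherwise the
  enlarged windows of its two children towards \<open>u\<close> and \<open>w\<close> are disjoint,
  and those of \<open>u\<close> and \<open>w\<close> nest in them.\<close>

lemma outside:
  assumes u: "u < n" and w: "w < n" "w \<notin> sub u"
  shows "pos w < pos u \<or> pos u + (1 + 1 / real D) * cap D (sz u) \<le> pos w"
proof -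
  have "w \<in> sub ((p ^^ k) u) \<Longrightarrow> ?thesis" for k
  proof (induction k)
    case 0 then show ?case using w by simp
  next
    case (Suc k)
    define c where "c = (p ^^ k) u"
    have c: "c < n" "u \<in> sub c" using u funpow_less by (auto simp: c_def subtree_def)
    show ?case
    proof (cases "w \<in> sub c")
      case True then show ?thesis using Suc.IH by (simp add: c_def)
    next
      case False
      have wp: "w \<in> sub (p c)" using Suc.prems by (simp add: c_def)
      have "c \<noteq> r" using False w sub_root by blast
      then have cc: "c \<in> ch (p c)" using c by (simp add: children_def)
      show ?thesis
      proof (cases "w = p c")
        case True
        have "pos w < pos u"
          unfolding True using pos_child[OF cc] shift_pos[of c] room_sub[OF c(2)] by linarith
        then show ?thesis ..
      next
        case wne: False
        obtain c' where c': "c' \<in> ch (p c)" "w \<in> sub c'" using sub_cases[OF wp wne] by blast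
        have ne: "port c \<noteq> port c'" using port_inj[OF cc c'(1)] c'(2) False by blast
        \<comment> \<open>The positive length makes the inequality strict when the branch of
          \<open>w\<close> comes first.\<close>
        have wpos: "(1 + 1 / real D) * cap D (sz w) > 0"
          using cap_pos[OF w(1)] by (intro mult_pos_pos add_pos_nonneg) auto
        have or: "pos c + (1 + 1 / real D) * cap D (sz c) \<le> pos c' \<or>
              pos c' + (1 + 1 / real D) * cap D (sz c') \<le> pos c"
        proof (cases "port c = 1")
          case True
          then show ?thesis using light_before_heavy[OF c'(1) cc] ne by simp
        next
          case h: False
          show ?thesis
          proof (cases "port c' = 1")
            case True
            then show ?thesis using light_before_heavy[OF cc c'(1)] h by simp
          next
            case False
            then have "port c > 1" "port c' > 1" using h port_range[OF cc] port_range[OF c'(1)] by linarith+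
            moreover have "port c < port c' \<or> port c' < port c" using ne by linarith
            ultimately show ?thesis using siblings_apart[OF cc c'(1)] siblings_apart[OF c'(1) cc] by force
          qed
        qed
        show ?thesis using or room_sub[OF c(2)] room_sub[OF c'(2)] wpos by linarith
      qed
    qed
  qed
  moreover obtain k where "(p ^^ k) u = r" using reaches_root u by blast
  ultimately show ?thesis using sub_root w(1) by metis
qed

text \<open>The successor puts the stored length above the exact window but within the enlarged
  one.\<close>

definition end_exp :: "nat \<Rightarrow> nat" where
  "end_exp v = Suc (lev D (cap D (sz v)))"

lemma cap_ge_1: "v < n \<Longrightarrow> 1 \<le> cap D (sz v)"
proof -
  assume "v < n"
  then have "1 \<le> real (sz v) powr (1 + 32 / real D)" using sz_pos by (intro ge_one_powr_ge_zero) auto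
  then have "1 * 1 \<le> 2 * real D * real (sz v) powr (1 + 32 / real D)" using D4 by (intro mult_mono) auto
  then show ?thesis by (simp add: cap_def)
qed

lemma end_exp:
  assumes "v < n"
  shows "cap D (sz v) < geo D (end_exp v)" "geo D (end_exp v) \<le> (1 + 1 / real D) * cap D (sz v)"
proof -
  have D: "D > 0" using D4 by simp
  show "cap D (sz v) < geo D (end_exp v)" unfolding end_exp_def
    by (rule less_geo_Suc_lev[OF D cap_ge_1[OF assms]])
  show "geo D (end_exp v) \<le> (1 + 1 / real D) * cap D (sz v)"
    unfolding end_exp_def geo_Suc using mult_right_mono[OF geo_lev_le[OF D cap_ge_1[OF assms]], of "1 + 1 / real D"]
    by (simp add: mult.commute)
qed

text \<open>Descendants of \<open>u\<close> lie in its exact window and all other nodes avoid the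
  enlarged one, so the rounded end decides between up and down. The block end and the slots then
  identify the child.\<close>

lemma hop_correct:
  assumes u: "u < n" and w: "w < n" and ne: "u \<noteq> w"
  shows "hop D (pos u, end_exp u, e u, A u) (pos w) = route_answer n r p port u w"
proof (cases "w \<in> sub u")
  case False
  then have "route_answer n r p port u w = 0" by (simp add: route_answer_def)
  moreover have "pos w < pos u \<or> geo D (end_exp u) \<le> real (pos w) - real (pos u)"
    using outside[OF u w False] end_exp(2)[OF u] by auto
  ultimately show ?thesis by (simp add: hop_def)
next
  case True
  obtain c where c: "c \<in> ch u" "w \<in> sub c" using sub_cases[OF True] ne by blast
  have ans: "route_answer n r p port u w = port c" by (rule route_answer_child[OF c])
  have pc: "p c = u" using childD(3)[OF c(1)] .
  have rs: "pos w + cap D (sz w) \<le> pos u + cap D (sz u)" "pos u \<le> pos w"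
    using room_sub[OF True] by auto
  have inside: "\<not> (pos w < pos u \<or> geo D (end_exp u) \<le> real (pos w) - real (pos u))"
    using rs end_exp(1)[OF u] cap_pos[OF w] by auto
  have rc: "pos c \<le> pos w" "pos w + cap D (sz w) \<le> pos c + cap D (sz c)"
    using room_sub[OF c(2)] by auto
  have pos_c: "pos c = pos u + shift c" by (rule pos_child[OF c(1)])
  show ?thesis
  proof (cases "port c = 1")
    case True
    then have "pos u + blk D (e u) \<le> pos w" using rc pos_c pc by (simp add: shift_def)
    then show ?thesis using inside ans True by (simp add: hop_def)
  next
    case False
    then have p1: "port c > 1" using port_range[OF c(1)] by linarith
    define j where "j = port c - 1"
    have j: "port c = Suc j" "1 \<le> j" using p1 by (auto simp: j_def)
    note lt = light[OF u c(1) p1]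
    have sh: "shift c = off D (e u) (A u) j" using False pc by (simp add: shift_def j_def)
    have "0 \<le> cap D (sz c) / real D" by (simp add: cap_def)
    then have hi: "real (off D (e u) (A u) j) + cap D (sz c) \<le> real (off D (e u) (A u) (Suc j))"
      using lt j by (simp add: algebra_simps)
    have "real (pos w) < real (pos u + off D (e u) (A u) (Suc j))"
      using rc(2) pos_c sh hi cap_pos[OF w] by simp
    then have up: "pos w < pos u + off D (e u) (A u) (Suc j)" by (simp only: of_nat_less_iff)
    have lo: "pos u + off D (e u) (A u) j \<le> pos w" using rc(1) pos_c sh by simp
    have "\<not> pos u + blk D (e u) \<le> pos w" using up lt j by simp
    moreover have "(THE j. 1 \<le> j \<and> pos u + off D (e u) (A u) j \<le> pos w \<and>
        pos w < pos u + off D (e u) (A u) (Suc j)) = j"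
    proof -
      have "(\<lambda>j. 1 \<le> j \<and> pos u + off D (e u) (A u) j \<le> pos w \<and> pos w < pos u + off D (e u) (A u) (Suc j)) =
        (\<lambda>j. 1 \<le> j \<and> off D (e u) (A u) j \<le> pos w - pos u \<and> pos w - pos u < off D (e u) (A u) (Suc j))"
        using rs(2) by (auto simp: fun_eq_iff)
      then show ?thesis using the_slot[OF j(2), of D "e u" "A u" "pos w - pos u"] lo up rs(2) by simp
    qed
    ultimately show ?thesis using inside ans j by (simp add: hop_def)
  qed
qed

section \<open>Ranges of the parameters\<close>

lemma cap_sz_le: "cap D (sz v) \<le> cap D (2 ^ L)"
proof -
  have "sz v \<le> 2 ^ L" using sz_le n_le order_trans by blast
  then have "real (sz v) \<le> real (2 ^ L)" by (simp only: of_nat_le_iff)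
  then show ?thesis by (intro cap_mono) auto
qed

lemma pos_bound:
  assumes "v < n" shows "pos v < 2 ^ pos_bits D L"
proof -
  have D: "D > 0" using D4 by simp
  have "real (pos v) < cap D (sz r)"
    using room_sub[OF sub_root[OF assms]] pos_root cap_pos[OF assms] by simp
  also have "\<dots> \<le> 2 ^ pos_bits D L"
    using cap_sz_le[of r] cap_le_pos_bits[OF D, of L] by linarith
  finally have "real (pos v) < real (2 ^ pos_bits D L)" by simp
  then show ?thesis by (simp only: of_nat_less_iff)
qed

lemma log_cap_le:
  assumes "v < n" shows "real D * log 2 (cap D (sz v)) \<le> real (D * pos_bits D L)"
proof -
  have D: "D > 0" using D4 by simp
  have "cap D (sz v) \<le> 2 ^ pos_bits D L"
    using cap_sz_le[of v] cap_le_pos_bits[OF D, of L] by linarith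
  then have "log 2 (cap D (sz v)) \<le> pos_bits D L"
    using cap_pos[OF assms] by (subst log_le_iff) (auto simp: powr_realpow)
  then show ?thesis by (simp add: mult_left_mono)
qed

lemma exp_bounds:
  assumes "v < n" shows "e v \<le> D * pos_bits D L" "end_exp v \<le> D * pos_bits D L + 1"
proof -
  have D: "D > 0" using D4 by simp
  show "e v \<le> D * pos_bits D L"
    using e_le[OF assms] log_cap_le[OF assms] by (simp flip: of_nat_le_iff[where 'a=real])
  have "real (lev D (cap D (sz v))) \<le> real (D * pos_bits D L)"
    using lev_le[OF D cap_ge_1[OF assms]] log_cap_le[OF assms] by linarith
  then show "end_exp v \<le> D * pos_bits D L + 1" unfolding end_exp_def by (simp only: of_nat_le_iff Suc_eq_plus1 add_le_cancel_right)
qed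

end

definition params :: "nat \<Rightarrow> nat \<Rightarrow> (nat \<times> nat \<times> nat \<times> nat set) set" where
  "params D L = {..<2 ^ pos_bits D L} \<times> {..D * pos_bits D L + 1} \<times> {..D * pos_bits D L + 1} \<times>
     Pow {..2 * max_lev D L}"

context ported_tree
begin

lemma ex_placement:
  "\<exists>P. \<forall>u<n. P u \<in> params D L \<and>
     (\<forall>w<n. u \<noteq> w \<longrightarrow> hop D (P u) (fst (P w)) = route_answer n r p port u w)"
proof -
  obtain e A where eA: "\<And>v. v < n \<Longrightarrow> A v \<subseteq> {..2 * max_lev D L} \<and> real (e v) \<le> real D * log 2 (cap D (sz v)) \<and>
    real (blk D (e v)) \<le> cap D (sz v) \<and>
    (\<forall>c\<in>ch v. port c = 1 \<longrightarrow> real (blk D (e v)) + cap D (sz c) \<le> cap D (sz v)) \<and>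
    (\<forall>c\<in>ch v. port c > 1 \<longrightarrow> off D (e v) (A v) (port c) \<le> blk D (e v) \<and>
      real (off D (e v) (A v) (port c - 1)) + (1 + 1 / real D) * cap D (sz c)
         \<le> real (off D (e v) (A v) (port c)))"
    using ex_node_params by metis
  interpret placed_tree n r p port D L e A
    by unfold_locales (use eA in blast)+
  have "(pos u, end_exp u, e u, A u) \<in> params D L" if "u < n" for u
    using pos_bound[OF that] exp_bounds[OF that] eA[OF that] by (simp add: params_def)
  then show ?thesis using hop_correct
    by (intro exI[of _ "\<lambda>u. (pos u, end_exp u, e u, A u)"]) simp
qed

end

subsection \<open>Label length\<close>

text \<open>Balances \<open>L / D\<close> against \<open>D * log 2 L\<close>; the added 4 ensures
  \<open>D \<ge> 4\<close> for every \<open>L\<close>.\<close>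

definition denom :: "nat \<Rightarrow> nat" where
  "denom L = nat \<lceil>sqrt (real L / log 2 (real L))\<rceil> + 4"

definition exp_bits :: "nat \<Rightarrow> nat \<Rightarrow> nat" where
  "exp_bits D L = nat \<lceil>log 2 (real (D * pos_bits D L + 2))\<rceil>"

definition label_length :: "nat \<Rightarrow> nat" where
  "label_length L = (let D = denom L in pos_bits D L + 2 * exp_bits D L + 2 * max_lev D L + 1)"

text \<open>Counting suffices: any injective code that depends on \<open>L\<close> alone can be
  inverted by the decoder.\<close>

lemma ex_code:
  "\<exists>\<phi>. inj_on \<phi> (params (denom L) L) \<and> \<phi> ` params (denom L) L \<subseteq> {xs :: bool list. length xs = label_length L}"
proof -
  define D where "D = denom L"
  let ?Q = "D * pos_bits D L + 2"
  have "real ?Q \<le> 2 powr real (exp_bits D L)"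
  proof (subst log_le_iff[symmetric])
    show "log 2 (real ?Q) \<le> real (exp_bits D L)" unfolding exp_bits_def by linarith
  qed (simp, subst of_nat_0_less_iff, simp)
  then have "real ?Q \<le> real (2 ^ exp_bits D L)" by (simp add: powr_realpow)
  then have Q: "?Q \<le> 2 ^ exp_bits D L" by (simp only: of_nat_le_iff)
  have "card (params D L) = 2 ^ pos_bits D L * (?Q * (?Q * 2 ^ (2 * max_lev D L + 1)))"
    by (simp add: params_def card_cartesian_product card_Pow)
  also have "\<dots> \<le> 2 ^ pos_bits D L * (2 ^ exp_bits D L * (2 ^ exp_bits D L * 2 ^ (2 * max_lev D L + 1)))"
    using Q by (intro mult_le_mono) auto
  also have "\<dots> = 2 ^ label_length L"
    unfolding label_length_def D_def[symmetric] Let_def power_add power_even_eq power2_eq_square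
    by (simp add: mult_ac)
  also have "\<dots> = card {xs :: bool list. length xs = label_length L}"
    using card_lists_length_eq[of "UNIV :: bool set" "label_length L"] by simp
  finally have "card (params D L) \<le> \<dots>" .
  moreover have "finite (params D L)" by (simp add: params_def)
  moreover have "finite {xs :: bool list. length xs = label_length L}"
    using finite_lists_length_eq[of "UNIV :: bool set" "label_length L"] by simp
  ultimately show ?thesis unfolding D_def using inj_on_iff_card_le by blast
qed

text \<open>For \<open>S = sqrt (x / log 2 x)\<close> both \<open>x / S\<close> and
  \<open>S * log 2 x\<close> are \<open>sqrt (x * log 2 x)\<close>; all other terms beyond
  \<open>L\<close> are of no larger order.\<close>

lemma label_length_bound:
  "\<exists>C \<ge> 0. \<exists>N. \<forall>L \<ge> N. real (label_length L) \<le> real L + C * sqrt (real L * log 2 (real L))"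
proof -
  define S where "S x = sqrt (x / log 2 x)" for x :: real
  \<comment> \<open>\<open>S + 5\<close> bounds \<open>denom\<close>, and 41 = 5 + 33 + 2 + 1
    collects the constants of \<open>pos_bits\<close>, the two ceilings in \<open>exp_bits\<close>
    and the final bit.\<close>
  define g where "g x = S x + 32 * (x / S x) +
      2 * log 2 ((S x + 5) * (x + (S x + 5) + 32 * (x / S x) + 33) + 2) +
      2 * ((S x + 5) * log 2 (x + 1)) + 41" for x
  have "g \<in> O(\<lambda>x. sqrt (x * log 2 x))"
    unfolding g_def S_def log_def by real_asymp
  then obtain C where C: "C > 0" "eventually (\<lambda>x. norm (g x) \<le> C * norm (sqrt (x * log 2 x))) at_top"
    by (rule landau_o.bigE)
  then obtain X where X: "\<And>x. x \<ge> X \<Longrightarrow> norm (g x) \<le> C * norm (sqrt (x * log 2 x))"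
    by (auto simp: eventually_at_top_linorder)
  have "real (label_length L) \<le> real L + C * sqrt (real L * log 2 (real L))"
    if "L \<ge> max 2 (nat \<lceil>X\<rceil>)" for L
  proof -
    define D where "D = denom L"
    have L: "L \<ge> 2" "real L \<ge> X" using that by linarith+
    have S: "S L > 0" unfolding S_def using L by (auto intro!: divide_pos_pos)
    have D: "S L \<le> D" "D \<le> S L + 5"
      unfolding D_def denom_def S_def[symmetric] using S by linarith+
    have "real (L div D) \<le> real L / real D" by (rule of_nat_div_le_of_nat)
    also have "\<dots> \<le> real L / S L" using D S by (intro divide_left_mono) auto
    finally have "real (L div D) \<le> \<dots>" .
    then have pb: "real (pos_bits D L) \<le> real L + (S L + 5) + 32 * (real L / S L) + 33"
      using D unfolding pos_bits_def by simp
    have "real (D * pos_bits D L + 2) \<le> (S L + 5) * (real L + (S L + 5) + 32 * (real L / S L) + 33) + 2"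
      using D pb S by (simp del: distrib_left_numeral add: mult_mono)
    moreover have ge1: "1 \<le> real (D * pos_bits D L + 2)"
      by (subst of_nat_1[symmetric], subst of_nat_le_iff) simp
    ultimately have "log 2 (real (D * pos_bits D L + 2)) \<le> log 2 ((S L + 5) * (real L + (S L + 5) + 32 * (real L / S L) + 33) + 2)"
      by (intro log_mono) linarith+
    moreover have "0 \<le> log 2 (real (D * pos_bits D L + 2))"
      by (rule zero_le_log_cancel_iff[THEN iffD2, OF _ _ ge1]) (use ge1 in linarith)+
    ultimately have eb: "real (exp_bits D L) \<le> log 2 ((S L + 5) * (real L + (S L + 5) + 32 * (real L / S L) + 33) + 2) + 1"
      unfolding exp_bits_def by linarith
    have "real (max_lev D L) \<le> real D * log 2 (real L + 1)"
      unfolding max_lev_def by (intro of_nat_floor mult_nonneg_nonneg) auto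
    also have "\<dots> \<le> (S L + 5) * log 2 (real L + 1)" using D by (intro mult_right_mono) auto
    finally have ml: "real (max_lev D L) \<le> \<dots>" .
    have "real (label_length L) \<le> real L + g (real L)"
      using pb eb ml unfolding label_length_def D_def[symmetric] Let_def g_def by simp
    also have "g (real L) \<le> C * sqrt (real L * log 2 (real L))" using X[OF L(2)] L(1) by simp
    finally show ?thesis by simp
  qed
  then show ?thesis using C(1) by (meson less_imp_le)
qed

text \<open>Replacing the rounded logarithm by \<open>log 2 n\<close> costs at most 1 in the main
  term and a factor 2 in the root, hence \<open>2 * C + 1\<close>.\<close>

lemma label_length_log_bound:
  "\<exists>C N. \<forall>n \<ge> N. real (label_length (nat \<lceil>log 2 (real n)\<rceil>)) \<le>
     log 2 (real n) + C * sqrt (log 2 (real n) * log 2 (log 2 (real n)))"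
proof -
  obtain C N where C: "C \<ge> 0" and N: "\<And>L. L \<ge> N \<Longrightarrow> real (label_length L) \<le> real L + C * sqrt (real L * log 2 (real L))"
    using label_length_bound by blast
  have "eventually (\<lambda>x::real. (x + 1) * log 2 (x + 1) \<le> 4 * (x * log 2 x)) at_top"
    "eventually (\<lambda>x::real. 1 \<le> sqrt (x * log 2 x)) at_top"
    unfolding log_def by real_asymp+
  then have "eventually (\<lambda>x::real. (x + 1) * log 2 (x + 1) \<le> 4 * (x * log 2 x) \<and> 1 \<le> sqrt (x * log 2 x)
      \<and> x \<ge> 1 \<and> x \<ge> real N) at_top"
    using eventually_ge_at_top by (intro eventually_conj) auto
  moreover have "filterlim (\<lambda>n. log 2 (real n)) at_top sequentially" by real_asymp
  ultimately have "eventually (\<lambda>n. let x = log 2 (real n) in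
      (x + 1) * log 2 (x + 1) \<le> 4 * (x * log 2 x) \<and> 1 \<le> sqrt (x * log 2 x)
      \<and> x \<ge> 1 \<and> x \<ge> real N) sequentially"
    unfolding Let_def by (rule eventually_compose_filterlim)
  then have "eventually (\<lambda>n. real (label_length (nat \<lceil>log 2 (real n)\<rceil>)) \<le>
     log 2 (real n) + (2 * C + 1) * sqrt (log 2 (real n) * log 2 (log 2 (real n)))) sequentially"
  proof eventually_elim
    case (elim n)
    define x where "x = log 2 (real n)"
    define L where "L = nat \<lceil>x\<rceil>"
    have x: "(x + 1) * log 2 (x + 1) \<le> 4 * (x * log 2 x)" "1 \<le> sqrt (x * log 2 x)" "x \<ge> 1" "x \<ge> real N"
      using elim by (auto simp: x_def Let_def)
    have L: "x \<le> L" "L \<le> x + 1" "L \<ge> N" using x unfolding L_def by linarith+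
    have "real L * log 2 (real L) \<le> (x + 1) * log 2 (x + 1)"
      using L x by (intro mult_mono) auto
    then have "sqrt (real L * log 2 (real L)) \<le> sqrt (4 * (x * log 2 x))"
      using x by (intro real_sqrt_le_mono) linarith
    then have "sqrt (real L * log 2 (real L)) \<le> 2 * sqrt (x * log 2 x)"
      by (simp add: real_sqrt_mult)
    then have *: "C * sqrt (real L * log 2 (real L)) \<le> C * (2 * sqrt (x * log 2 x))"
      by (intro mult_left_mono C)
    have "real (label_length L) \<le> x + (2 * C + 1) * sqrt (x * log 2 x)"
    proof -
      have "(2 * C + 1) * sqrt (x * log 2 x) = C * (2 * sqrt (x * log 2 x)) + sqrt (x * log 2 x)"
        by (simp add: algebra_simps)
      with * show ?thesis using N[OF L(3)] L(2) x(2) by linarith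
    qed
    then show ?case by (simp add: L_def x_def)
  qed
  then show ?thesis unfolding eventually_at_top_linorder by blast
qed

theorem mainTheorem3:
  shows "\<exists>enc dec. canonical_routing_scheme enc dec \<and>
    (\<exists>C::real. \<exists>N::nat. \<forall>n\<ge>N. \<forall>r p. rooted_tree n r p \<longrightarrow>
       (\<forall>v<n. real (length (fst (enc n r p) v))
          \<le> log 2 (real n) + C * sqrt (log 2 (real n) * log 2 (log 2 (real n)))))"
proof -
  \<comment> \<open>One code per \<open>L\<close>, fixed before any tree is given, is shared by
    encoder and decoder.\<close>
  obtain \<phi> :: "nat \<Rightarrow> _ \<Rightarrow> bool list" where \<phi>: "\<And>L. inj_on (\<phi> L) (params (denom L) L)"
    "\<And>L x. x \<in> params (denom L) L \<Longrightarrow> length (\<phi> L x) = label_length L"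
    using ex_code unfolding image_subset_iff mem_Collect_eq by metis
  define \<psi> where "\<psi> L = inv_into (params (denom L) L) (\<phi> L)" for L
  define dec where "dec L a b = hop (denom L) (\<psi> L a) (fst (\<psi> L b))" for L a b
  \<comment> \<open>Bundling all demands on labels and ports of one tree lets a single choice yield
    the encoder.\<close>
  define good where "good n r p lp \<longleftrightarrow>
     canonical_ports n r p (snd lp) \<and>
     (\<forall>u<n. length (fst lp u) = label_length (nat \<lceil>log 2 (real n)\<rceil>)) \<and>
     (\<forall>u<n. \<forall>w<n. u \<noteq> w \<longrightarrow>
        dec (nat \<lceil>log 2 (real n)\<rceil>) (fst lp u) (fst lp w) = route_answer n r p (snd lp) u w)" for n r p lp
  have "\<exists>lp. good n r p lp" if tree: "rooted_tree n r p" for n r p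
  proof -
    define L where "L = nat \<lceil>log 2 (real n)\<rceil>"
    have n: "n > 0" using tree by (auto simp: rooted_tree_def)
    have "log 2 (real n) \<le> real L" unfolding L_def by linarith
    then have "real n \<le> real (2 ^ L)" using n by (subst (asm) log_le_iff) (auto simp: powr_realpow)
    then have nL: "n \<le> 2 ^ L" by (simp only: of_nat_le_iff)
    obtain port where port: "canonical_ports n r p port" using ex_canonical_ports by blast
    interpret ported_tree n r p port "denom L" L
      by unfold_locales (use tree port nL in \<open>auto simp: denom_def\<close>)
    obtain P where P: "\<And>u. u < n \<Longrightarrow> P u \<in> params (denom L) L"
      "\<And>u w. u < n \<Longrightarrow> w < n \<Longrightarrow> u \<noteq> w \<Longrightarrow> hop (denom L) (P u) (fst (P w)) = route_answer n r p port u w"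
      using ex_placement by blast
    have "\<psi> L (\<phi> L (P u)) = P u" if "u < n" for u
      unfolding \<psi>_def using \<phi>(1) P(1)[OF that] by (rule inv_into_f_f)
    then have "good n r p (\<lambda>u. \<phi> L (P u), port)"
      unfolding good_def L_def[symmetric] using port \<phi>(2) P by (simp add: dec_def)
    then show ?thesis by blast
  qed
  then obtain enc where enc: "\<And>n r p. rooted_tree n r p \<Longrightarrow> good n r p (enc n r p)"
    by metis
  obtain C N where N: "\<And>n. n \<ge> N \<Longrightarrow> real (label_length (nat \<lceil>log 2 (real n)\<rceil>)) \<le>
     log 2 (real n) + C * sqrt (log 2 (real n) * log 2 (log 2 (real n)))"
    using label_length_log_bound by blast
  have "canonical_routing_scheme enc dec"
    unfolding canonical_routing_scheme_def using enc by (simp add: good_def)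
  moreover have "\<forall>n\<ge>N. \<forall>r p. rooted_tree n r p \<longrightarrow>
       (\<forall>v<n. real (length (fst (enc n r p) v))
          \<le> log 2 (real n) + C * sqrt (log 2 (real n) * log 2 (log 2 (real n))))"
    using enc N by (simp add: good_def)
  ultimately show ?thesis by blast
qed

end
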